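(* Let $n\ge 2$ and let $A$ be a c.e. set. If $Q_n(A)$ holds, then $A$ is $n$-tardy.
   Context: Sets are subsets of $\omega$; $\{W_{e}\}_{e\in\omega}$ is the standard listing of the c.e. sets with standard stagewise enumeration $\{W_{e,s}\}_{s\in\omega}$ (only numbers less than $s$ belong to $W_{e,s}$). $\overline{A}=\omega\setminus A$; $X\subseteq^* Y$ means $X\setminus Y$ is finite. $n$-c.e. sets: for $n\ge 1$, a set $X$ is $n$-c.e. iff there are c.e. sets $X_1,\dots,X_n$ such that $X=(X_1-X_2)\cup\dots\cup(X_{n-2}-X_{n-1})\cup X_n$ if $n$ is odd, and $X=(X_1-X_2)\cup\dots\cup(X_{n-1}-X_n)$ if $n$ is even. Fix an effective listing of all such presentations (sequences $W_{e_1},\dots,W_{e_n}$ of c.e. sets given by indices); $X^n_e$ denotes the $e$-th $n$-c.e. set in this listing, and $X^n_{e,s}$ its stage-$s$ approximation, obtained by replacing each $W_{e_i}$ by $W_{e_i,s}$. $n$-tardy: let $A$ be c.e. with a computable enumeration $\{A_s\}_{s\in\omega}$. $A$ is $n$-tardy iff for every nondecreasing total computable function $p$ there is an $e$ such that $X^n_e=\overline{A}$ and, for all $x$ and all $s$, $x\in X^n_{e,s}$ implies $x\notin A_{p(s)}$. (This does not depend on the choice of enumeration of $A$.) $A\subset_m C$ (equivalently $C\supset_m A$; $A$ is a major subset of $C$): $A\subseteq C$, $C-A$ is infinite, and for all $e$, $\overline{C}\subseteq W_e$ implies $\overline{A}\subseteq^* W_e$. $S\sqsubset C$: there is a c.e.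 set $B$ with $S\cup B=C$ and $S\cap B=\emptyset$. The properties $Q_m$, $m\ge 2$ (all set quantifiers range over c.e. sets). For $k\ge 1$, $Q_{2k}(A)$ is the statement $$(\exists C\supset_m A)(\forall B_1\subseteq C)(\forall B_2\subseteq B_1)\cdots(\forall B_k\subseteq B_{k-1})(\exists D_1\subseteq C)(\exists D_2\subseteq D_1)\cdots(\exists D_k\subseteq D_{k-1})$$ $$(\forall S\sqsubset C)(\exists T_1\supseteq\overline{C})(\exists T_2\subseteq T_1)\cdots(\exists T_k\subseteq T_{k-1})\,[\Phi\implies\Psi],$$ where $\Phi$ is: $B_i\cap(S-A)=D_i\cap(S-A)$ for all $1\le i\le k$; and $\Psi$ is: $(A\cup T_{i+1})\cap(S\cap T_i)=B_i\cap(S\cap T_i)$ for all $1\le i<k$, and $A\cap(S\cap T_k)=B_k\cap(S\cap T_k)$. For $k\ge 1$, $Q_{2k+1}(A)$ is the statement $(\exists Y\subseteq\overline{A})\,Q_{2k}(A\cup Y)$. *)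

theory Defs
  imports Main "HOL-Library.Nat_Bijection"
begin

section \<open>Partial recursive functions\<close>

text \<open>
  Programs for the unary partial recursive functions.  Functions of several arguments are
  handled through the Cantor pairing function \<^const>\<open>prod_encode\<close>, whose two inverses are the
  basic functions \<open>Fst\<close> and \<open>Snd\<close>.
\<close>

datatype recf =
    Zero | Succ | Fst | Snd
  | Fork recf recf
  | Comp recf recf
  | Prec recf recf
  | Mini recf

text \<open>
  \<open>run c x y t\<close>: on input \<open>x\<close> the program \<open>c\<close> halts with output \<open>y\<close> after \<open>t\<close> steps, a step
  being one application of a rule.  Minimisation carries its starting point: on input
  \<open>(a, m)\<close>, \<open>Mini f\<close> searches for the least \<open>y \<ge> m\<close> with \<open>f (a, y) = 0\<close>, and diverges if it
  meets an argument where \<open>f\<close> diverges; the usual operator is the case \<open>m = 0\<close>.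
\<close>

inductive run :: "recf \<Rightarrow> nat \<Rightarrow> nat \<Rightarrow> nat \<Rightarrow> bool" where
  zero: "run Zero x 0 1"
| succ: "run Succ x (Suc x) 1"
| fst: "run Fst x (fst (prod_decode x)) 1"
| snd: "run Snd x (snd (prod_decode x)) 1"
| fork: "\<lbrakk>run f x u t1; run g x v t2\<rbrakk> \<Longrightarrow> run (Fork f g) x (prod_encode (u, v)) (t1 + t2 + 1)"
| comp: "\<lbrakk>run g x u t1; run f u v t2\<rbrakk> \<Longrightarrow> run (Comp f g) x v (t1 + t2 + 1)"
| prec_0: "run f a v t \<Longrightarrow> run (Prec f g) (prod_encode (a, 0)) v (t + 1)"
| prec_Suc: "\<lbrakk>run (Prec f g) (prod_encode (a, m)) u t1;
              run g (prod_encode (a, prod_encode (m, u))) v t2\<rbrakk>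
             \<Longrightarrow> run (Prec f g) (prod_encode (a, Suc m)) v (t1 + t2 + 1)"
| mini_found: "run f (prod_encode (a, m)) 0 t \<Longrightarrow> run (Mini f) (prod_encode (a, m)) m (t + 1)"
| mini_next: "\<lbrakk>run f (prod_encode (a, m)) (Suc u) t1; run (Mini f) (prod_encode (a, Suc m)) v t2\<rbrakk>
             \<Longrightarrow> run (Mini f) (prod_encode (a, m)) v (t1 + t2 + 1)"

lemma run_deterministic:
  "run c x y t \<Longrightarrow> run c x y' t' \<Longrightarrow> y' = y \<and> t' = t"
proof (induction arbitrary: y' t' rule: run.induct)
  case zero
  from zero.prems show ?case by cases auto
next
  case succ
  from succ.prems show ?case by cases auto
next
  case fst
  from fst.prems show ?case by cases auto
next
  case snd
  from snd.prems show ?case by cases auto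
next
  case fork
  from fork.prems show ?case by cases (use fork.IH in blast)
next
  case comp
  from comp.prems show ?case by cases (use comp.IH in blast)
next
  case prec_0
  from prec_0.prems show ?case by cases (use prec_0.IH in auto)
next
  case prec_Suc
  from prec_Suc.prems show ?case by cases (auto dest!: prec_Suc.IH)
next
  case mini_found
  from mini_found.prems show ?case by cases (use mini_found.IH in auto)
next
  case mini_next
  from mini_next.prems show ?case by cases (use mini_next.IH in fastforce)+
qed

definition computable :: "(nat \<Rightarrow> nat) \<Rightarrow> bool" where
  "computable f \<longleftrightarrow> (\<exists>c. \<forall>x. \<exists>t. run c x (f x) t)"

text \<open>The effective listing of all programs.\<close>

function recf_of :: "nat \<Rightarrow> recf" where
  "recf_of n =
    (if n = 0 then Zero else if n = 1 then Succ else if n = 2 then Fst else if n = 3 then Snd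
     else let q = (n - 4) div 4; a = fst (prod_decode q); b = snd (prod_decode q) in
       if n mod 4 = 0 then Fork (recf_of a) (recf_of b)
       else if n mod 4 = 1 then Comp (recf_of a) (recf_of b)
       else if n mod 4 = 2 then Prec (recf_of a) (recf_of b)
       else Mini (recf_of q))"
  by pat_completeness auto

lemma prod_decode_le: "fst (prod_decode q) \<le> q" "snd (prod_decode q) \<le> q"
  by (metis le_prod_encode_1 le_prod_encode_2 prod.collapse prod_decode_inverse)+

termination recf_of
proof (relation "measure id", goal_cases)
  case 1
  show ?case by simp
qed (use prod_decode_le in \<open>fastforce intro: le_less_trans[of _ "(_ - 4) div 4"]\<close>)+

declare recf_of.simps [simp del]

lemma recf_of_surj: "\<exists>n. recf_of n = c"
proof (induction c)
  case Zero
  have "recf_of 0 = Zero" by (simp add: recf_of.simps)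
  then show ?case ..
next
  case Succ
  have "recf_of 1 = Succ" by (simp add: recf_of.simps)
  then show ?case ..
next
  case Fst
  have "recf_of 2 = Fst" by (simp add: recf_of.simps)
  then show ?case ..
next
  case Snd
  have "recf_of 3 = Snd" by (simp add: recf_of.simps)
  then show ?case ..
next
  case (Fork f g)
  then obtain a b where "recf_of a = f" "recf_of b = g" by blast
  then have "recf_of (4 * prod_encode (a, b) + 4) = Fork f g"
    by (subst recf_of.simps) simp
  then show ?case ..
next
  case (Comp f g)
  then obtain a b where "recf_of a = f" "recf_of b = g" by blast
  then have "recf_of (4 * prod_encode (a, b) + 5) = Comp f g"
    by (subst recf_of.simps) (simp add: Let_def div_Suc mod_Suc)
  then show ?case ..
next
  case (Prec f g)
  then obtain a b where "recf_of a = f" "recf_of b = g" by blast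
  then have "recf_of (4 * prod_encode (a, b) + 6) = Prec f g"
    by (subst recf_of.simps) (simp add: Let_def div_Suc mod_Suc)
  then show ?case ..
next
  case (Mini f)
  then obtain a where "recf_of a = f" by blast
  then have "recf_of (4 * a + 7) = Mini f"
    by (subst recf_of.simps) (simp add: Let_def div_Suc mod_Suc)
  then show ?case ..
qed


section \<open>Computably enumerable sets\<close>

definition W :: "nat \<Rightarrow> nat set" where
  "W e = {x. \<exists>y t. run (recf_of e) x y t}"

definition W_at :: "nat \<Rightarrow> nat \<Rightarrow> nat set" where
  "W_at e s = {x. x < s \<and> (\<exists>y t. t < s \<and> run (recf_of e) x y t)}"

lemma W_at_mono: "s \<le> s' \<Longrightarrow> W_at e s \<subseteq> W_at e s'"
  unfolding W_at_def by (auto dest: less_le_trans)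

lemma W_eq_UN_W_at: "W e = (\<Union>s. W_at e s)"
proof
  show "W e \<subseteq> (\<Union>s. W_at e s)"
  proof
    fix x assume "x \<in> W e"
    then obtain y t where "run (recf_of e) x y t" by (auto simp: W_def)
    then have "x \<in> W_at e (Suc (max x t))" by (auto simp: W_at_def less_Suc_eq_le intro: max.cobounded2)
    then show "x \<in> (\<Union>s. W_at e s)" by blast
  qed
qed (auto simp: W_def W_at_def)

definition ce :: "nat set \<Rightarrow> bool" where
  "ce A \<longleftrightarrow> (\<exists>e. A = W e)"

text \<open>
  \<^const>\<open>set_encode\<close> gives the canonical index \<open>\<Sum>x\<in>F. 2 ^ x\<close> of a finite set \<open>F\<close>, so the stages
  form a strong array.
\<close>

definition computable_enumeration :: "(nat \<Rightarrow> nat set) \<Rightarrow> nat set \<Rightarrow> bool" where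
  "computable_enumeration As A \<longleftrightarrow>
     (\<forall>s. finite (As s)) \<and> (\<forall>s. As s \<subseteq> As (Suc s)) \<and> (\<Union>s. As s) = A \<and>
     computable (\<lambda>s. set_encode (As s))"


section \<open>$n$-c.e. sets and tardiness\<close>

text \<open>\<open>diff_union [X\<^sub>1, \<dots>, X\<^sub>n] = (X\<^sub>1 - X\<^sub>2) \<union> (X\<^sub>3 - X\<^sub>4) \<union> \<dots>\<close>, ending in \<open>X\<^sub>n\<close> if \<open>n\<close> is odd.\<close>

fun diff_union :: "'a set list \<Rightarrow> 'a set" where
  "diff_union [] = {}"
| "diff_union [X] = X"
| "diff_union (X # Y # Xs) = (X - Y) \<union> diff_union Xs"

text \<open>For \<open>n \<ge> 1\<close> this is a computable bijection from the numbers to the lists of length \<open>n\<close>.\<close>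

fun tuple_of :: "nat \<Rightarrow> nat \<Rightarrow> nat list" where
  "tuple_of 0 e = []"
| "tuple_of (Suc 0) e = [e]"
| "tuple_of (Suc (Suc n)) e =
     fst (prod_decode e) # tuple_of (Suc n) (snd (prod_decode e))"

lemma tuple_of_surj:
  assumes "n \<ge> 1" and "length es = n"
  shows "\<exists>e. tuple_of n e = es"
  using assms
proof (induction n arbitrary: es rule: nat_induct_at_least)
  case base
  then show ?case by (auto simp: length_Suc_conv)
next
  case (Suc n)
  then obtain d ds where es: "es = d # ds" "length ds = n" by (auto simp: length_Suc_conv)
  with Suc.IH obtain e where e: "tuple_of n e = ds" by blast
  from \<open>1 \<le> n\<close> obtain m where "n = Suc m" by (cases n) auto
  with es e have "tuple_of (Suc n) (prod_encode (d, e)) = es" by simp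
  then show ?case ..
qed

definition X_set :: "nat \<Rightarrow> nat \<Rightarrow> nat set" where
  "X_set n e = diff_union (map W (tuple_of n e))"

definition X_at :: "nat \<Rightarrow> nat \<Rightarrow> nat \<Rightarrow> nat set" where
  "X_at n e s = diff_union (map (\<lambda>i. W_at i s) (tuple_of n e))"

text \<open>
  Tardiness does not depend on the computable enumeration of \<open>A\<close>; the definition asks for the
  condition along every one of them.
\<close>

definition tardy :: "nat \<Rightarrow> nat set \<Rightarrow> bool" where
  "tardy n A \<longleftrightarrow> ce A \<and>
     (\<forall>As. computable_enumeration As A \<longrightarrow>
       (\<forall>p. mono p \<and> computable p \<longrightarrow>
         (\<exists>e. X_set n e = - A \<and> (\<forall>x s. x \<in> X_at n e s \<longrightarrow> x \<notin> As (p s)))))"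


section \<open>The properties $Q_n$\<close>

definition major_subset :: "nat set \<Rightarrow> nat set \<Rightarrow> bool"  (infix "\<subset>m" 50) where
  "A \<subset>m C \<longleftrightarrow>
     A \<subseteq> C \<and> infinite (C - A) \<and> (\<forall>e. - C \<subseteq> W e \<longrightarrow> finite (- A - W e))"

definition ce_split :: "nat set \<Rightarrow> nat set \<Rightarrow> bool"  (infix "\<sqsubset>c" 50) where
  "S \<sqsubset>c C \<longleftrightarrow> (\<exists>B. ce B \<and> S \<union> B = C \<and> S \<inter> B = {})"

text \<open>
  A block of \<open>k\<close> like quantifiers over nested c.e. sets \<open>B\<^sub>1 \<supseteq> \<dots> \<supseteq> B\<^sub>k\<close> becomes one quantifier over
  a sequence, of which only the values at \<open>1, \<dots>, k\<close> matter.
\<close>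

definition ce_chain :: "nat \<Rightarrow> (nat \<Rightarrow> nat set) \<Rightarrow> bool" where
  "ce_chain k B \<longleftrightarrow> (\<forall>i\<in>{1..k}. ce (B i)) \<and> (\<forall>i\<in>{1..<k}. B (i + 1) \<subseteq> B i)"

definition Q_even :: "nat \<Rightarrow> nat set \<Rightarrow> bool" where
  "Q_even k A \<longleftrightarrow>
     (\<exists>C. ce C \<and> A \<subset>m C \<and>
       (\<forall>B. ce_chain k B \<and> B 1 \<subseteq> C \<longrightarrow>
         (\<exists>D. ce_chain k D \<and> D 1 \<subseteq> C \<and>
           (\<forall>S. ce S \<and> S \<sqsubset>c C \<longrightarrow>
             (\<exists>T. ce_chain k T \<and> - C \<subseteq> T 1 \<and>
               ((\<forall>i\<in>{1..k}. B i \<inter> (S - A) = D i \<inter> (S - A)) \<longrightarrow>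
                 (\<forall>i\<in>{1..<k}. (A \<union> T (i + 1)) \<inter> (S \<inter> T i) = B i \<inter> (S \<inter> T i)) \<and>
                 A \<inter> (S \<inter> T k) = B k \<inter> (S \<inter> T k)))))))"

definition Q_odd :: "nat \<Rightarrow> nat set \<Rightarrow> bool" where
  "Q_odd k A \<longleftrightarrow> (\<exists>Y. ce Y \<and> Y \<subseteq> - A \<and> Q_even k (A \<union> Y))"

text \<open>Meaningful for \<open>n \<ge> 2\<close> only.\<close>

definition Q :: "nat \<Rightarrow> nat set \<Rightarrow> bool" where
  "Q n A \<longleftrightarrow> (if even n then Q_even (n div 2) A else Q_odd (n div 2) A)"

end

(*
  The opponent's sets D_1, ..., D_k announce that a number may enter A.  Let B_i contain x exactly if
  x is announced by D_1, ..., D_i at a stage s with x not in A_{p(s)}.  Then B_i and D_i agree outside A,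
  so the opponent has to supply T_1, ..., T_k, and (T_1 - D_1) u (T_2 - D_2) u ... is the complement of A on
  S and shows elements of A only until their announcement, that is, it obeys the delay p.

  As D depends on B, the plan is carried out for all guesses (d, t) of indices of D and T: the elements of C are
  distributed to disjoint sets S_d, and B follows W_d on S_d.  Whether a guess fulfils what the argument
  needs is a Pi_2 condition, and some guess does.  Each x goes to the least guess that looks correct up to x
  before x enters C.  Wrong guesses receive finitely many elements, and the least correct guess
  (d, t) is seen to be correct at every x outside C; since A is a major subset of C, the set S_d therefore
  contains almost all of C - A.  The guess (d, t) need not be the opponent's actual answer.
*)
theory Submission
  imports Defs "HOL.Filter"
begin

text \<open>The classes are indexed by \<open>d\<close> alone, because the opponent chooses
  \<open>T\<close> after seeing \<open>S\<close>; the component \<open>t\<close> of a guess only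
  helps to judge it. Whether a guess is correct depends on the class of its \<open>d\<close>, and
  the classes in turn depend on which guesses look correct. This is resolved by recursion on
  \<open>x\<close>: the colour of \<open>x\<close> looks only at smaller numbers. Finitely many
  exceptions, all below some \<open>m\<close>, remain at the end. Repairing them changes the sets
  announced by the opponent and thus their indices, and a new index may enumerate later than the old
  one. But \<open>d\<close> and \<open>m\<close> become known only after \<open>B\<close> has been
  played. So a delay \<open>h\<close>, independent of \<open>d\<close> and \<open>m\<close>, is
  fixed beforehand, and \<open>B\<close> tests lateness at \<open>p (s + h s)\<close> instead of
  \<open>p s\<close>. For odd levels, the extra set \<open>Y\<close> is disjoint from
  \<open>A\<close>, so its elements need no announcement.\<close>

section \<open>Computable functions and decidable predicates\<close>

abbreviation pfst :: "nat \<Rightarrow> nat" where "pfst z \<equiv> fst (prod_decode z)"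
abbreviation psnd :: "nat \<Rightarrow> nat" where "psnd z \<equiv> snd (prod_decode z)"

named_theorems comp_intros

lemma computableI: "(\<And>x. \<exists>t. run c x (f x) t) \<Longrightarrow> computable f"
  unfolding computable_def by blast

lemma run_Id: "run (Fork Fst Snd) x x 3"
  using run.fork[OF run.fst[of x] run.snd[of x]] by (simp add: numeral_3_eq_3)

lemma computable_comp:
  assumes "computable F" "computable f"
  shows "computable (\<lambda>x. F (f x))"
proof -
  from assms obtain a b where "\<And>x. \<exists>t. run a x (F x) t" "\<And>x. \<exists>t. run b x (f x) t"
    unfolding computable_def by blast
  then have "\<exists>t. run (Comp a b) x (F (f x)) t" for x by (blast intro: run.comp)
  then show ?thesis by (rule computableI)
qed

lemma computable_id [comp_intros]: "computable (\<lambda>x. x)"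
  using run_Id by (blast intro: computableI)

lemma computable_Suc [comp_intros]: "computable f \<Longrightarrow> computable (\<lambda>x. Suc (f x))"
  by (rule computable_comp[of Suc]) (blast intro: computableI run.succ)

lemma computable_fst [comp_intros]: "computable f \<Longrightarrow> computable (\<lambda>x. pfst (f x))"
  by (rule computable_comp[of pfst]) (blast intro: computableI run.fst)

lemma computable_snd [comp_intros]: "computable f \<Longrightarrow> computable (\<lambda>x. psnd (f x))"
  by (rule computable_comp[of psnd]) (blast intro: computableI run.snd)

fun const_prog :: "nat \<Rightarrow> recf" where
  "const_prog 0 = Zero"
| "const_prog (Suc n) = Comp Succ (const_prog n)"

lemma run_const_prog: "run (const_prog n) x n (2 * n + 1)"
proof (induction n)
  case 0
  then show ?case using run.zero by simp
next
  case (Suc n)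
  from run.comp[OF this run.succ] show ?case by simp
qed

lemma computable_const [comp_intros]: "computable (\<lambda>x. n)"
  using run_const_prog by (blast intro: computableI)

lemma computable_pair [comp_intros]:
  assumes "computable f" "computable g"
  shows "computable (\<lambda>x. prod_encode (f x, g x))"
proof -
  from assms obtain a b where "\<And>x. \<exists>t. run a x (f x) t" "\<And>x. \<exists>t. run b x (g x) t"
    unfolding computable_def by blast
  then have "\<exists>t. run (Fork a b) x (prod_encode (f x, g x)) t" for x by (blast intro: run.fork)
  then show ?thesis by (rule computableI)
qed

lemma computable_comp2:
  assumes "computable (\<lambda>z. F (pfst z) (psnd z))" "computable f" "computable g"
  shows "computable (\<lambda>x. F (f x) (g x))"
  using computable_comp[OF assms(1) computable_pair[OF assms(2,3)]] by simp

text \<open>The whole input \<open>x\<close> is the parameter of the recursion, so the base, the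
  step and the number of rounds may all depend on it. The arithmetic below and bounded search are
  instances.\<close>

lemma computable_rec_nat:
  assumes "computable f" "computable (\<lambda>z. g (pfst z) (pfst (psnd z)) (psnd (psnd z)))" "computable n"
  shows "computable (\<lambda>x. rec_nat (f x) (g x) (n x))"
proof -
  from assms(1,2) obtain a b where a: "\<And>x. \<exists>t. run a x (f x) t"
    and b: "\<And>z. \<exists>t. run b z (g (pfst z) (pfst (psnd z)) (psnd (psnd z))) t"
    unfolding computable_def by blast
  have "\<exists>t. run (Prec a b) (prod_encode (x, m)) (rec_nat (f x) (g x) m) t" for x m
  proof (induction m)
    case 0
    then show ?case using a run.prec_0 by force
  next
    case (Suc m)
    then obtain t where "run (Prec a b) (prod_encode (x, m)) (rec_nat (f x) (g x) m) t" ..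
    moreover obtain t' where "run b (prod_encode (x, prod_encode (m, rec_nat (f x) (g x) m)))
        (g x m (rec_nat (f x) (g x) m)) t'"
      using b[of "prod_encode (x, prod_encode (m, rec_nat (f x) (g x) m))"] by auto
    ultimately show ?case by (auto intro: run.prec_Suc)
  qed
  then have "\<exists>t. run (Prec a b) z (rec_nat (f (pfst z)) (g (pfst z)) (psnd z)) t" for z
    by (metis prod.collapse prod_decode_inverse)
  then have "computable (\<lambda>z. rec_nat (f (pfst z)) (g (pfst z)) (psnd z))"
    by (rule computableI)
  from computable_comp2[OF this computable_id assms(3)] show ?thesis .
qed

lemma computable_add [comp_intros]:
  assumes "computable f" "computable g" shows "computable (\<lambda>x. f x + g x)"
proof -
  have "rec_nat a (\<lambda>_. Suc) b = a + b" for a b :: nat by (induction b) auto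
  with computable_rec_nat[of f "\<lambda>_ _. Suc" g] assms show ?thesis by (simp add: comp_intros)
qed

lemma computable_mult [comp_intros]:
  assumes "computable f" "computable g" shows "computable (\<lambda>x. f x * g x)"
proof -
  have "rec_nat 0 (\<lambda>_ u. u + a) b = a * b" for a b :: nat by (induction b) auto
  with computable_rec_nat[of "\<lambda>_. 0" "\<lambda>x _ u. u + f x" g] assms(2)
    computable_comp[OF assms(1), of pfst]
  show ?thesis by (simp add: comp_intros)
qed

lemma computable_diff [comp_intros]:
  assumes "computable f" "computable g" shows "computable (\<lambda>x. f x - g x)"
proof -
  have "rec_nat 0 (\<lambda>m _. m) b = b - 1" for b :: nat by (induction b) auto
  with computable_rec_nat[of "\<lambda>_. 0" "\<lambda>_ m _. m"]
  have p: "computable h \<Longrightarrow> computable (\<lambda>x. h x - 1)" for h by (simp add: comp_intros)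
  have "rec_nat a (\<lambda>_ u. u - 1) b = a - b" for a b :: nat by (induction b) auto
  with computable_rec_nat[of f "\<lambda>_ _ u. u - 1" g] assms p show ?thesis by (simp add: comp_intros)
qed

lemma computable_power [comp_intros]:
  assumes "computable f" "computable g" shows "computable (\<lambda>x. f x ^ g x)"
proof -
  have "rec_nat 1 (\<lambda>_ u. u * a) b = a ^ b" for a b :: nat by (induction b) auto
  with computable_rec_nat[of "\<lambda>_. 1" "\<lambda>x _ u. u * f x" g] assms(2)
    computable_comp[OF assms(1), of pfst]
  show ?thesis by (simp add: comp_intros)
qed

section \<open>Decidable predicates and bounded quantifiers\<close>

definition decidable :: "(nat \<Rightarrow> bool) \<Rightarrow> bool" where
  "decidable P \<longleftrightarrow> computable (\<lambda>x. if P x then 1 else 0)"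

lemma decidable_comp: "decidable P \<Longrightarrow> computable f \<Longrightarrow> decidable (\<lambda>x. P (f x))"
  unfolding decidable_def by (rule computable_comp)

lemma decidable_comp2:
  "decidable (\<lambda>z. P (pfst z) (psnd z)) \<Longrightarrow> computable f \<Longrightarrow> computable g \<Longrightarrow>
   decidable (\<lambda>x. P (f x) (g x))"
  using decidable_comp[of "\<lambda>z. P (pfst z) (psnd z)" "\<lambda>x. prod_encode (f x, g x)"]
  by (simp add: comp_intros)

lemma decidable_const [comp_intros]: "decidable (\<lambda>x. b)"
  unfolding decidable_def by (simp add: comp_intros)

lemma decidable_not [comp_intros]:
  assumes "decidable P" shows "decidable (\<lambda>x. \<not> P x)"
proof -
  have "computable (\<lambda>x. 1 - (if P x then 1 else 0))"
    using assms unfolding decidable_def by (intro comp_intros)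
  moreover have "(\<lambda>x. 1 - (if P x then 1 else 0)) = (\<lambda>x. if \<not> P x then 1 else 0 :: nat)" by auto
  ultimately show ?thesis by (simp only: decidable_def)
qed

lemma decidable_conj [comp_intros]:
  assumes "decidable P" "decidable R" shows "decidable (\<lambda>x. P x \<and> R x)"
proof -
  have "computable (\<lambda>x. (if P x then 1 else 0) * (if R x then 1 else 0))"
    using assms unfolding decidable_def by (intro comp_intros)
  moreover have "(\<lambda>x. (if P x then 1 else 0) * (if R x then 1 else 0))
    = (\<lambda>x. if P x \<and> R x then 1 else 0 :: nat)" by auto
  ultimately show ?thesis by (simp only: decidable_def)
qed

lemma decidable_disj [comp_intros]:
  "decidable P \<Longrightarrow> decidable R \<Longrightarrow> decidable (\<lambda>x. P x \<or> R x)"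
  using decidable_not[OF decidable_conj[OF decidable_not[of P] decidable_not[of R]]] by simp

lemma decidable_imp [comp_intros]:
  "decidable P \<Longrightarrow> decidable R \<Longrightarrow> decidable (\<lambda>x. P x \<longrightarrow> R x)"
  unfolding imp_conv_disj by (intro comp_intros)

lemma decidable_iff [comp_intros]:
  "decidable P \<Longrightarrow> decidable R \<Longrightarrow> decidable (\<lambda>x. P x \<longleftrightarrow> R x)"
  unfolding iff_conv_conj_imp by (intro comp_intros)

lemma decidable_le [comp_intros]:
  assumes "computable f" "computable g" shows "decidable (\<lambda>x. f x \<le> g x)"
proof -
  have "computable (\<lambda>x. 1 - (f x - g x))" using assms by (intro comp_intros)
  moreover have "(\<lambda>x. 1 - (f x - g x)) = (\<lambda>x. if f x \<le> g x then 1 else 0)" by auto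
  ultimately show ?thesis by (simp add: decidable_def)
qed

lemma decidable_less [comp_intros]:
  "computable f \<Longrightarrow> computable g \<Longrightarrow> decidable (\<lambda>x. f x < g x)"
  unfolding not_le[symmetric] by (intro comp_intros)

lemma decidable_eq [comp_intros]:
  "computable f \<Longrightarrow> computable g \<Longrightarrow> decidable (\<lambda>x. f x = g x)"
  unfolding order_eq_iff[of "f _"] by (intro comp_intros)

lemma computable_if [comp_intros]:
  assumes "decidable P" "computable f" "computable g"
  shows "computable (\<lambda>x. if P x then f x else g x)"
proof -
  have "computable (\<lambda>x. (if P x then 1 else 0) * f x + (if \<not> P x then 1 else 0) * g x)"
    using assms decidable_not[OF assms(1)] unfolding decidable_def by (intro comp_intros)
  moreover have "(\<lambda>x. (if P x then 1 else 0) * f x + (if \<not> P x then 1 else 0) * g x)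
    = (\<lambda>x. if P x then f x else g x)" by auto
  ultimately show ?thesis by simp
qed

text \<open>The search is a primitive recursion whose accumulator remembers a hit. Later formulas
  bound their quantifiers in the form \<open>y<b\<close> to match this rule.\<close>

lemma decidable_bex [comp_intros]:
  assumes "decidable (\<lambda>z. P (pfst z) (psnd z))" "computable b"
  shows "decidable (\<lambda>x. \<exists>y<b x. P x y)"
proof -
  have "rec_nat 0 (\<lambda>m u. if P x m then 1 else u) n = (if \<exists>y<n. P x y then 1 else (0::nat))" for x n
    by (induction n) (auto simp: less_Suc_eq)
  moreover have "computable (\<lambda>x. rec_nat 0 (\<lambda>m u. if P x m then 1 else u) (b x))"
    by (rule computable_rec_nat) (intro comp_intros decidable_comp2[OF assms(1)] assms)+
  ultimately show ?thesis by (simp add: decidable_def)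
qed

lemma decidable_ball [comp_intros]:
  assumes "decidable (\<lambda>z. P (pfst z) (psnd z))" "computable b"
  shows "decidable (\<lambda>x. \<forall>y<b x. P x y)"
  using decidable_not[OF decidable_bex[OF decidable_not[OF assms(1)] assms(2)]] by (simp only: not_ex not_not de_Morgan_conj imp_conv_disj)

lemma decidable_Ball_finite:
  assumes "finite I" "\<And>i. i \<in> I \<Longrightarrow> decidable (P i)"
  shows "decidable (\<lambda>x. \<forall>i\<in>I. P i x)"
  using assms by (induction I) (simp_all add: decidable_const decidable_conj)

section \<open>Unbounded search\<close>

lemma run_Mini:
  assumes "run d z v t" "d = Mini c" "\<And>z y t. run c z y t \<Longrightarrow> y = g z"
  shows "g (prod_encode (pfst z, v)) = 0 \<and> psnd z \<le> v \<and>
    (\<forall>u. psnd z \<le> u \<longrightarrow> u < v \<longrightarrow> g (prod_encode (pfst z, u)) \<noteq> 0)"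
  using assms
proof (induction rule: run.induct)
  case (mini_found f a m t)
  then show ?case by fastforce
next
  case (mini_next f a m u t1 v t2)
  then have "Suc u = g (prod_encode (a, m))" by blast
  then have "g (prod_encode (a, m)) \<noteq> 0" by simp
  moreover from mini_next have "g (prod_encode (a, v)) = 0" "Suc m \<le> v"
    "\<And>u. Suc m \<le> u \<Longrightarrow> u < v \<Longrightarrow> g (prod_encode (a, u)) \<noteq> 0" by auto
  ultimately show ?case using le_eq_less_or_eq[of m] by (auto simp: Suc_le_eq)
qed simp_all

text \<open>The equivalence also covers divergence: without a zero there is no output. Hence one
  construction serves both total searches and domains of partial functions.\<close>

lemma Mini_prog:
  assumes "computable g"
  shows "\<exists>c. \<forall>x v. (\<exists>t. run c x v t) \<longleftrightarrow>
    g (prod_encode (x, v)) = 0 \<and> (\<forall>u<v. g (prod_encode (x, u)) \<noteq> 0)"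
proof -
  from assms obtain c where c: "\<And>x. \<exists>t. run c x (g x) t" unfolding computable_def by blast
  have det: "y = g z" if "run c z y t" for z y t
    using c[of z] run_deterministic[OF that] by blast
  define d where "d = Comp (Mini c) (Fork (Fork Fst Snd) Zero)"
  have start: "run (Fork (Fork Fst Snd) Zero) x (prod_encode (x, 0)) 5" for x
    using run.fork[OF run_Id[of x] run.zero] by simp
  have "(\<exists>t. run d x v t) \<longleftrightarrow>
    g (prod_encode (x, v)) = 0 \<and> (\<forall>u<v. g (prod_encode (x, u)) \<noteq> 0)" for x v
  proof
    assume "\<exists>t. run d x v t"
    then obtain t where "run d x v t" ..
    then obtain u t1 t2 where "run (Fork (Fork Fst Snd) Zero) x u t1" "run (Mini c) u v t2"
      unfolding d_def by cases
    with run_deterministic[OF start] have "run (Mini c) (prod_encode (x, 0)) v t2" by blast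
    from run_Mini[OF this refl, of g] det
    show "g (prod_encode (x, v)) = 0 \<and> (\<forall>u<v. g (prod_encode (x, u)) \<noteq> 0)" by auto
  next
    assume v: "g (prod_encode (x, v)) = 0 \<and> (\<forall>u<v. g (prod_encode (x, u)) \<noteq> 0)"
    \<comment> \<open>The halting run is assembled backwards, from the zero \<open>v\<close> down to
      the starting point.\<close>
    have "m \<le> v \<Longrightarrow> \<exists>t. run (Mini c) (prod_encode (x, m)) v t" for m
    proof (induction m rule: inc_induct)
      case base
      from c[of "prod_encode (x, v)"] v show ?case by (auto intro: run.mini_found)
    next
      case (step m)
      from step.hyps v obtain u where "g (prod_encode (x, m)) = Suc u" by (meson not0_implies_Suc)
      with c[of "prod_encode (x, m)"] step.IH show ?case by (auto intro: run.mini_next)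
    qed
    then obtain t where "run (Mini c) (prod_encode (x, 0)) v t" by blast
    with start[of x] show "\<exists>t. run d x v t" unfolding d_def by (blast intro: run.comp)
  qed
  then show ?thesis by blast
qed

lemma computable_Least:
  assumes "decidable (\<lambda>z. P (pfst z) (psnd z))" "\<And>x. \<exists>y. P x y"
  shows "computable (\<lambda>x. LEAST y. P x y)"
proof -
  define g where "g z = 1 - (if P (pfst z) (psnd z) then 1 else 0 :: nat)" for z
  have g: "g (prod_encode (x, y)) = 0 \<longleftrightarrow> P x y" for x y by (simp add: g_def)
  have "computable g"
    unfolding g_def using assms(1) by (intro comp_intros) (simp only: decidable_def)
  from Mini_prog[OF this] obtain c where
    c: "\<And>x v. (\<exists>t. run c x v t) \<longleftrightarrow> P x v \<and> (\<forall>u<v. \<not> P x u)"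
    unfolding g by blast
  show ?thesis
  proof (rule computableI)
    fix x
    show "\<exists>t. run c x (LEAST y. P x y) t"
      unfolding c by (intro conjI allI impI LeastI_ex[OF assms(2)]) (rule not_less_Least)
  qed
qed

text \<open>
  A number \<open>l\<close> codes an infinite sequence, of which any finite part can be prescribed; codes of finite
  sequences come with a separate length.
\<close>

definition idx :: "nat \<Rightarrow> nat \<Rightarrow> nat" where
  "idx l i = pfst (rec_nat l (\<lambda>_. psnd) i)"

lemma computable_idx [comp_intros]:
  assumes "computable f" "computable g" shows "computable (\<lambda>x. idx (f x) (g x))"
  unfolding idx_def
  by (rule computable_fst, rule computable_rec_nat) (intro comp_intros assms)+

lemma idx_0: "idx l 0 = pfst l"
  by (simp add: idx_def)

lemma idx_Suc: "idx l (Suc i) = idx (psnd l) i"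
proof -
  have "rec_nat l (\<lambda>_. psnd) (Suc i) = rec_nat (psnd l) (\<lambda>_. psnd) i"
    by (induction i) simp_all
  then show ?thesis by (simp only: idx_def)
qed

lemma idx_exists: "\<exists>l. \<forall>i\<le>n. idx l i = f i"
proof (induction n arbitrary: f)
  case 0
  have "idx (prod_encode (f 0, 0)) 0 = f 0" by (simp add: idx_0)
  then show ?case by auto
next
  case (Suc n)
  from Suc.IH[of "\<lambda>i. f (Suc i)"] obtain l where l: "\<And>i. i \<le> n \<Longrightarrow> idx l i = f (Suc i)" by blast
  have "idx (prod_encode (f 0, l)) i = f i" if "i \<le> Suc n" for i
    using that l by (cases i) (simp_all add: idx_0 idx_Suc)
  then show ?case by blast
qed

lemma idx_exists_set:
  assumes "finite Z" shows "\<exists>n l. Z = idx l ` {..<n}"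
proof -
  from finite_list[OF assms] obtain zs where zs: "set zs = Z" by blast
  from idx_exists[of "length zs" "\<lambda>i. zs ! i"] obtain l where
    l: "\<And>i. i \<le> length zs \<Longrightarrow> idx l i = zs ! i" by blast
  have "Z = idx l ` {..<length zs}"
    unfolding zs[symmetric] set_conv_nth using l[OF less_imp_le] by (auto simp: image_iff)
  then show ?thesis by blast
qed

section \<open>Semidecidable predicates\<close>

text \<open>A Sigma_1 form rather than an index: closure properties need no programs, and
  approximations by stages are at hand.\<close>

definition semidecidable :: "(nat \<Rightarrow> bool) \<Rightarrow> bool" where
  "semidecidable P \<longleftrightarrow>
     (\<exists>R. decidable (\<lambda>z. R (pfst z) (psnd z)) \<and> (\<forall>x. P x \<longleftrightarrow> (\<exists>s. R x s)))"

named_theorems semi_intros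

lemma semidecidableI:
  "decidable (\<lambda>z. R (pfst z) (psnd z)) \<Longrightarrow> semidecidable (\<lambda>x. \<exists>s. R x s)"
  unfolding semidecidable_def by blast

lemma semidecidable_if_decidable: "decidable P \<Longrightarrow> semidecidable P"
  unfolding semidecidable_def
  by (rule exI[of _ "\<lambda>x s. P x"]) (simp add: decidable_comp[of P pfst] computable_fst[OF computable_id])

lemma semidecidable_comp:
  assumes "semidecidable P" "computable f"
  shows "semidecidable (\<lambda>x. P (f x))"
proof -
  from assms(1) obtain R where R: "decidable (\<lambda>z. R (pfst z) (psnd z))" "\<And>x. P x \<longleftrightarrow> (\<exists>s. R x s)"
    unfolding semidecidable_def by blast
  show ?thesis unfolding R(2)
    by (rule semidecidableI)
      (intro decidable_comp2[OF R(1)] comp_intros computable_comp[OF assms(2)])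
qed

lemma semidecidable_comp2:
  "semidecidable (\<lambda>z. P (pfst z) (psnd z)) \<Longrightarrow> computable f \<Longrightarrow> computable g \<Longrightarrow>
   semidecidable (\<lambda>x. P (f x) (g x))"
  using semidecidable_comp[of "\<lambda>z. P (pfst z) (psnd z)" "\<lambda>x. prod_encode (f x, g x)"]
  by (simp add: comp_intros)

lemma ex_prod_decode: "(\<exists>s. F (pfst s) (psnd s)) \<longleftrightarrow> (\<exists>a b. F a b)"
proof
  assume "\<exists>a b. F a b"
  then obtain a b where "F a b" by blast
  then have "F (pfst (prod_encode (a, b))) (psnd (prod_encode (a, b)))" by simp
  then show "\<exists>s. F (pfst s) (psnd s)" ..
qed blast

lemma semidecidable_ex [semi_intros]:
  assumes "semidecidable (\<lambda>z. P (pfst z) (psnd z))"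
  shows "semidecidable (\<lambda>x. \<exists>y. P x y)"
proof -
  from assms obtain R where R: "decidable (\<lambda>z. R (pfst z) (psnd z))"
      "\<And>z. P (pfst z) (psnd z) \<longleftrightarrow> (\<exists>s. R z s)"
    unfolding semidecidable_def by blast
  have "P x y \<longleftrightarrow> (\<exists>s. R (prod_encode (x, y)) s)" for x y
    using R(2)[of "prod_encode (x, y)"] by simp
  then have "(\<exists>y. P x y) \<longleftrightarrow> (\<exists>s. R (prod_encode (x, pfst s)) (psnd s))" for x
    by (simp only: ex_prod_decode[of "\<lambda>y. R (prod_encode (x, y))"])
  moreover have "semidecidable (\<lambda>x. \<exists>s. R (prod_encode (x, pfst s)) (psnd s))"
    by (rule semidecidableI) (intro decidable_comp2[OF R(1)] comp_intros)
  ultimately show ?thesis by simp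
qed

text \<open>Searching all witnesses below \<open>s\<close> makes the approximation monotone, which
  the limits in \<open>s\<close> and the colouring rely on.\<close>

lemma semidecidable_approx:
  assumes "semidecidable P"
  shows "\<exists>R. decidable (\<lambda>z. R (pfst z) (psnd z)) \<and> (\<forall>x. P x \<longleftrightarrow> (\<exists>s. R x s)) \<and>
    (\<forall>x s s'. s \<le> s' \<longrightarrow> R x s \<longrightarrow> R x s')"
proof -
  from assms obtain R where R: "decidable (\<lambda>z. R (pfst z) (psnd z))" "\<And>x. P x \<longleftrightarrow> (\<exists>s. R x s)"
    unfolding semidecidable_def by blast
  have "decidable (\<lambda>z. \<exists>s<psnd z. R (pfst z) s)"
    by (intro comp_intros decidable_comp2[OF R(1)])
  moreover have "P x \<longleftrightarrow> (\<exists>s. \<exists>s'<s. R x s')" for x using R(2) by blast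
  moreover have "(\<exists>i<s. R x i) \<Longrightarrow> s \<le> s' \<Longrightarrow> \<exists>i<s'. R x i" for x s s'
    using less_le_trans by blast
  ultimately show ?thesis
    by (intro exI[of _ "\<lambda>x s. \<exists>s'<s. R x s'"]) blast
qed

lemma semidecidable_disj [semi_intros]:
  assumes "semidecidable P" "semidecidable P'"
  shows "semidecidable (\<lambda>x. P x \<or> P' x)"
proof -
  from assms(1) obtain R where R: "decidable (\<lambda>z. R (pfst z) (psnd z))" "\<And>x. P x \<longleftrightarrow> (\<exists>s. R x s)"
    unfolding semidecidable_def by blast
  from assms(2) obtain R' where R': "decidable (\<lambda>z. R' (pfst z) (psnd z))" "\<And>x. P' x \<longleftrightarrow> (\<exists>s. R' x s)"
    unfolding semidecidable_def by blast
  show ?thesis unfolding R(2) R'(2) ex_disj_distrib[symmetric]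
    by (rule semidecidableI) (intro comp_intros R(1) R'(1))
qed

lemma semidecidable_conj [semi_intros]:
  assumes "semidecidable P" "semidecidable P'"
  shows "semidecidable (\<lambda>x. P x \<and> P' x)"
proof -
  from assms(1) obtain R where R: "decidable (\<lambda>z. R (pfst z) (psnd z))" "\<And>x. P x \<longleftrightarrow> (\<exists>s. R x s)"
    unfolding semidecidable_def by blast
  from assms(2) obtain R' where R': "decidable (\<lambda>z. R' (pfst z) (psnd z))" "\<And>x. P' x \<longleftrightarrow> (\<exists>s. R' x s)"
    unfolding semidecidable_def by blast
  have "(\<exists>s. R x s) \<and> (\<exists>s. R' x s) \<longleftrightarrow> (\<exists>s. R x (pfst s) \<and> R' x (psnd s))" for x
    by (simp only: ex_prod_decode[of "\<lambda>s s'. R x s \<and> R' x s'"]) blast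
  then show ?thesis unfolding R(2) R'(2)
    by (simp only:) (intro semidecidableI comp_intros decidable_comp2[OF R(1)] decidable_comp2[OF R'(1)])
qed

lemma semidecidable_Ball_finite:
  assumes "finite I" "\<And>i. i \<in> I \<Longrightarrow> semidecidable (P i)"
  shows "semidecidable (\<lambda>x. \<forall>i\<in>I. P i x)"
  using assms
  by (induction I) (simp_all add: semidecidable_conj semidecidable_if_decidable decidable_const)

section \<open>Computations as certificates\<close>

abbreviation (input) inp :: "nat \<Rightarrow> nat" where "inp q \<equiv> pfst (psnd q)"
abbreviation (input) outp :: "nat \<Rightarrow> nat" where "outp q \<equiv> pfst (psnd (psnd q))"
abbreviation (input) steps :: "nat \<Rightarrow> nat" where "steps q \<equiv> psnd (psnd (psnd q))"
abbreviation (input) stmt :: "nat \<Rightarrow> nat \<Rightarrow> nat \<Rightarrow> nat \<Rightarrow> nat" where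
  "stmt e x y t \<equiv> prod_encode (e, prod_encode (x, prod_encode (y, t)))"

text \<open>
  A statement \<open>run (recf_of e) x y t\<close> is coded by \<open>stmt e x y t\<close>, and \<open>justified q r r'\<close> says that \<open>q\<close>
  follows from \<open>r\<close> and \<open>r'\<close> by one rule of \<^const>\<open>run\<close>, ignoring the premises that the rule does
  not have.  Since the number of steps drops, sets closed under justification contain only true statements.
\<close>

definition justified :: "nat \<Rightarrow> nat \<Rightarrow> nat \<Rightarrow> bool" where
  "justified q r r' \<longleftrightarrow>
    pfst q = 0 \<and> outp q = 0 \<and> steps q = 1 \<or>
    pfst q = 1 \<and> outp q = Suc (inp q) \<and> steps q = 1 \<or>
    pfst q = 2 \<and> outp q = pfst (inp q) \<and> steps q = 1 \<or>
    pfst q = 3 \<and> outp q = psnd (inp q) \<and> steps q = 1 \<or>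
    (\<exists>c<pfst q. pfst q = 4 * c + 4 \<and>
      r = stmt (pfst c) (inp q) (pfst (outp q)) (steps r) \<and>
      r' = stmt (psnd c) (inp q) (psnd (outp q)) (steps r') \<and> steps q = steps r + steps r' + 1) \<or>
    (\<exists>c<pfst q. pfst q = 4 * c + 5 \<and>
      r = stmt (psnd c) (inp q) (outp r) (steps r) \<and>
      r' = stmt (pfst c) (outp r) (outp q) (steps r') \<and> steps q = steps r + steps r' + 1) \<or>
    (\<exists>c<pfst q. pfst q = 4 * c + 6 \<and> psnd (inp q) = 0 \<and>
      r = stmt (pfst c) (pfst (inp q)) (outp q) (steps r) \<and> steps q = steps r + 1) \<or>
    (\<exists>c<pfst q. pfst q = 4 * c + 6 \<and> (\<exists>m<psnd (inp q). psnd (inp q) = Suc m \<and>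
      r = stmt (pfst q) (prod_encode (pfst (inp q), m)) (outp r) (steps r) \<and>
      r' = stmt (psnd c) (prod_encode (pfst (inp q), prod_encode (m, outp r))) (outp q) (steps r') \<and>
      steps q = steps r + steps r' + 1)) \<or>
    (\<exists>c<pfst q. pfst q = 4 * c + 7 \<and> outp q = psnd (inp q) \<and>
      r = stmt c (inp q) 0 (steps r) \<and> steps q = steps r + 1) \<or>
    (\<exists>c<pfst q. pfst q = 4 * c + 7 \<and> outp r \<noteq> 0 \<and>
      r = stmt c (inp q) (outp r) (steps r) \<and>
      r' = stmt (pfst q) (prod_encode (pfst (inp q), Suc (psnd (inp q)))) (outp q) (steps r') \<and>
      steps q = steps r + steps r' + 1)"

lemma decidable_justified:
  assumes "computable f" "computable g" "computable h"
  shows "decidable (\<lambda>x. justified (f x) (g x) (h x))"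
proof -
  have "decidable (\<lambda>z. justified (pfst z) (pfst (psnd z)) (psnd (psnd z)))"
    unfolding justified_def by (intro comp_intros)
  from decidable_comp[OF this, of "\<lambda>x. prod_encode (f x, prod_encode (g x, h x))"] assms
  show ?thesis by (simp add: comp_intros)
qed

lemma justified_intros:
  "justified (stmt (4 * c + 4) x (prod_encode (u, v)) (t1 + t2 + 1))
     (stmt (pfst c) x u t1) (stmt (psnd c) x v t2)"
  "justified (stmt (4 * c + 5) x v (t1 + t2 + 1)) (stmt (psnd c) x u t1) (stmt (pfst c) u v t2)"
  "justified (stmt (4 * c + 6) (prod_encode (a, 0)) v (t + 1)) (stmt (pfst c) a v t) r"
  "justified (stmt (4 * c + 6) (prod_encode (a, Suc m)) v (t1 + t2 + 1))
     (stmt (4 * c + 6) (prod_encode (a, m)) u t1)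
     (stmt (psnd c) (prod_encode (a, prod_encode (m, u))) v t2)"
  "justified (stmt (4 * c + 7) (prod_encode (a, m)) m (t + 1)) (stmt c (prod_encode (a, m)) 0 t) r"
  "justified (stmt (4 * c + 7) (prod_encode (a, m)) v (t1 + t2 + 1))
     (stmt c (prod_encode (a, m)) (Suc u) t1) (stmt (4 * c + 7) (prod_encode (a, Suc m)) v t2)"
  by (simp_all add: justified_def exI[of _ c])

lemma recf_of_base: "recf_of 0 = Zero" "recf_of (Suc 0) = Succ" "recf_of 2 = Fst" "recf_of 3 = Snd"
  by (simp_all add: recf_of.simps)

lemma recf_of_node:
  "recf_of (4 * c + 4) = Fork (recf_of (pfst c)) (recf_of (psnd c))"
  "recf_of (4 * c + 5) = Comp (recf_of (pfst c)) (recf_of (psnd c))"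
  "recf_of (4 * c + 6) = Prec (recf_of (pfst c)) (recf_of (psnd c))"
  "recf_of (4 * c + 7) = Mini (recf_of c)"
  by (subst recf_of.simps, simp add: Let_def div_Suc mod_Suc)+

lemma code_cases:
  fixes e :: nat
  obtains "e = 0" | "e = 1" | "e = 2" | "e = 3" | c where "e = 4 * c + 4"
    | c where "e = 4 * c + 5" | c where "e = 4 * c + 6" | c where "e = 4 * c + 7"
proof -
  have "e < 4 \<or> (\<exists>c. e = 4 * c + 4 \<or> e = 4 * c + 5 \<or> e = 4 * c + 6 \<or> e = 4 * c + 7)" by presburger
  then show thesis using that by (auto simp: numeral_eq_Suc less_Suc_eq)
qed

lemma run_if_certified:
  assumes "\<And>q. q \<in> Z \<Longrightarrow> \<exists>r\<in>Z. \<exists>r'\<in>Z. justified q r r'"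
  shows "stmt e x y t \<in> Z \<Longrightarrow> run (recf_of e) x y t"
proof (induction t arbitrary: e x y rule: less_induct)
  case (less t)
  from assms[OF less.prems] obtain r r' where r: "r \<in> Z" "r' \<in> Z" "justified (stmt e x y t) r r'"
    by blast
  have IH: "run (recf_of e') x' y' t'" if "r0 = stmt e' x' y' t'" "r0 \<in> Z" "t' < t" for r0 e' x' y' t'
    using less.IH that by blast
  obtain a m where x: "x = prod_encode (a, m)" by (metis prod_decode_inverse surj_pair)
  obtain u v where y: "y = prod_encode (u, v)" by (metis prod_decode_inverse surj_pair)
  from r(3) show ?case
    unfolding justified_def
  proof (elim disjE exE conjE, goal_cases)
    case 1
    then show ?case using run.zero by (simp add: recf_of_base)
  next
    case 2
    then show ?case using run.succ by (simp add: recf_of_base)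
  next
    case 3
    then show ?case using run.fst by (simp add: recf_of_base)
  next
    case 4
    then show ?case using run.snd by (simp add: recf_of_base)
  next
    case (5 c)
    from run.fork[OF IH[OF 5(3) r(1)] IH[OF 5(4) r(2)]] 5(2,5) show ?case
      by (simp add: recf_of_node)
  next
    case (6 c)
    from run.comp[OF IH[OF 6(3) r(1)] IH[OF 6(4) r(2)]] 6(2,5) show ?case
      by (simp add: recf_of_node)
  next
    case (7 c)
    from run.prec_0[OF IH[OF 7(4) r(1)]] 7(2,3,5) x show ?case
      by (simp add: recf_of_node)
  next
    case (8 c k)
    from IH[OF 8(5) r(1)] 8(2,4,7) x have
      "run (Prec (recf_of (pfst c)) (recf_of (psnd c))) (prod_encode (a, k)) (outp r) (steps r)"
      by (simp add: recf_of_node)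
    from run.prec_Suc[OF this] IH[OF 8(6) r(2)] 8(2,4,7) x show ?case by (simp add: recf_of_node)
  next
    case (9 c)
    from IH[OF 9(4) r(1)] 9(2,3,5) x run.mini_found show ?case by (simp add: recf_of_node)
  next
    case (10 c)
    then obtain w where w: "outp r = Suc w" using not0_implies_Suc by blast
    from IH[OF 10(5) r(2)] 10(2,6) x have
      "run (Mini (recf_of c)) (prod_encode (a, Suc m)) y (steps r')"
      by (simp add: recf_of_node)
    from run.mini_next[OF _ this, of w "steps r"] IH[OF 10(4) r(1)] 10(2,6) x w
    show ?case by (simp add: recf_of_node)
  qed
qed

text \<open>Certificates have to be built for every index of a program, so an arbitrary index must
  split into indices of the parts.\<close>

lemma code_of:
  "recf_of e = Fork f g \<Longrightarrow> \<exists>c. e = 4 * c + 4 \<and> recf_of (pfst c) = f \<and> recf_of (psnd c) = g"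
  "recf_of e = Comp f g \<Longrightarrow> \<exists>c. e = 4 * c + 5 \<and> recf_of (pfst c) = f \<and> recf_of (psnd c) = g"
  "recf_of e = Prec f g \<Longrightarrow> \<exists>c. e = 4 * c + 6 \<and> recf_of (pfst c) = f \<and> recf_of (psnd c) = g"
  "recf_of e = Mini f \<Longrightarrow> \<exists>c. e = 4 * c + 7 \<and> recf_of c = f"
  "recf_of e = Zero \<Longrightarrow> e = 0" "recf_of e = Succ \<Longrightarrow> e = 1"
  "recf_of e = Fst \<Longrightarrow> e = 2" "recf_of e = Snd \<Longrightarrow> e = 3"
  by (cases e rule: code_cases; simp add: recf_of_base recf_of_node)+

definition certificate :: "nat set \<Rightarrow> bool" where
  "certificate Z \<longleftrightarrow> finite Z \<and> (\<forall>q\<in>Z. \<exists>r\<in>Z. \<exists>r'\<in>Z. justified q r r')"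

lemma certificate_extend:
  assumes "certificate Z" "r \<in> Z" "certificate Z'" "r' \<in> Z'" "justified q r r'"
  shows "\<exists>Z. certificate Z \<and> q \<in> Z"
  by (rule exI[of _ "insert q (Z \<union> Z')"]) (use assms in \<open>unfold certificate_def, blast\<close>)

text \<open>Axioms of \<open>run\<close> have no premises, so \<open>q\<close> can fill both premise
  positions itself.\<close>

lemma certificate_axiom: "justified q q q \<Longrightarrow> \<exists>Z. certificate Z \<and> q \<in> Z"
  by (rule exI[of _ "{q}"]) (simp add: certificate_def)

lemma certified_if_run:
  "run p x y t \<Longrightarrow> recf_of e = p \<Longrightarrow> \<exists>Z. certificate Z \<and> stmt e x y t \<in> Z"
proof (induction arbitrary: e rule: run.induct)
  case (zero x)
  then have "e = 0" by (rule code_of)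
  then show ?case by (intro certificate_axiom) (simp add: justified_def)
next
  case (succ x)
  then have "e = 1" by (rule code_of)
  then show ?case by (intro certificate_axiom) (simp add: justified_def)
next
  case (fst x)
  then have "e = 2" by (rule code_of)
  then show ?case by (intro certificate_axiom) (simp add: justified_def)
next
  case (snd x)
  then have "e = 3" by (rule code_of)
  then show ?case by (intro certificate_axiom) (simp add: justified_def)
next
  case (fork f x u t1 g v t2)
  from code_of(1)[OF fork.prems] obtain c where
    c: "e = 4 * c + 4" "recf_of (pfst c) = f" "recf_of (psnd c) = g" by blast
  from fork.IH(1)[OF c(2)] fork.IH(2)[OF c(3)] obtain Z Z' where
    "certificate Z" "stmt (pfst c) x u t1 \<in> Z" "certificate Z'" "stmt (psnd c) x v t2 \<in> Z'"
    by blast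
  then show ?case
    unfolding c(1) by (rule certificate_extend[OF _ _ _ _ justified_intros(1)])
next
  case (comp g x u t1 f v t2)
  from code_of(2)[OF comp.prems] obtain c where
    c: "e = 4 * c + 5" "recf_of (pfst c) = f" "recf_of (psnd c) = g" by blast
  from comp.IH(1)[OF c(3)] comp.IH(2)[OF c(2)] obtain Z Z' where
    "certificate Z" "stmt (psnd c) x u t1 \<in> Z" "certificate Z'" "stmt (pfst c) u v t2 \<in> Z'"
    by blast
  then show ?case
    unfolding c(1) by (rule certificate_extend[OF _ _ _ _ justified_intros(2)])
next
  case (prec_0 f a v t g)
  from code_of(3)[OF prec_0.prems] obtain c where
    c: "e = 4 * c + 6" "recf_of (pfst c) = f" "recf_of (psnd c) = g" by blast
  from prec_0.IH[OF c(2)] obtain Z where "certificate Z" "stmt (pfst c) a v t \<in> Z" by blast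
  from certificate_extend[OF this this justified_intros(3)] show ?case unfolding c(1) .
next
  case (prec_Suc f g a m u t1 v t2)
  from code_of(3)[OF prec_Suc.prems] obtain c where
    c: "e = 4 * c + 6" "recf_of (pfst c) = f" "recf_of (psnd c) = g" by blast
  from prec_Suc.IH(1)[OF prec_Suc.prems] prec_Suc.IH(2)[OF c(3)] obtain Z Z' where
    "certificate Z" "stmt e (prod_encode (a, m)) u t1 \<in> Z" "certificate Z'"
    "stmt (psnd c) (prod_encode (a, prod_encode (m, u))) v t2 \<in> Z'"
    by blast
  then show ?case
    unfolding c(1) by (rule certificate_extend[OF _ _ _ _ justified_intros(4)])
next
  case (mini_found f a m t)
  from code_of(4)[OF mini_found.prems] obtain c where c: "e = 4 * c + 7" "recf_of c = f" by blast
  from mini_found.IH[OF c(2)] obtain Z where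
    "certificate Z" "stmt c (prod_encode (a, m)) 0 t \<in> Z" by blast
  from certificate_extend[OF this this justified_intros(5)] show ?case unfolding c(1) .
next
  case (mini_next f a m u t1 v t2)
  from code_of(4)[OF mini_next.prems] obtain c where c: "e = 4 * c + 7" "recf_of c = f" by blast
  from mini_next.IH(1)[OF c(2)] mini_next.IH(2)[OF mini_next.prems] obtain Z Z' where
    "certificate Z" "stmt c (prod_encode (a, m)) (Suc u) t1 \<in> Z" "certificate Z'"
    "stmt e (prod_encode (a, Suc m)) v t2 \<in> Z'"
    by blast
  then show ?case
    unfolding c(1) by (rule certificate_extend[OF _ _ _ _ justified_intros(6)])
qed

text \<open>Finite sets become initial parts of coded sequences; after the quantifiers over
  \<open>n\<close> and \<open>l\<close> only bounded ones remain. Since \<open>e\<close> is a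
  variable here, this takes the place of a universal program.\<close>

lemma run_iff_certified:
  "run (recf_of e) x y t \<longleftrightarrow> (\<exists>n l.
    (\<forall>i<n. \<exists>j<n. \<exists>k<n. justified (idx l i) (idx l j) (idx l k)) \<and>
    (\<exists>i<n. idx l i = stmt e x y t))"
proof
  assume "run (recf_of e) x y t"
  from certified_if_run[OF this refl] obtain Z where Z: "certificate Z" "stmt e x y t \<in> Z" by blast
  from Z(1) have "finite Z" by (simp add: certificate_def)
  from idx_exists_set[OF this] obtain n l where Zn: "Z = idx l ` {..<n}" by blast
  from Z show "\<exists>n l.
    (\<forall>i<n. \<exists>j<n. \<exists>k<n. justified (idx l i) (idx l j) (idx l k)) \<and>
    (\<exists>i<n. idx l i = stmt e x y t)"
    unfolding certificate_def Zn
    by (rule_tac x = n in exI, rule_tac x = l in exI) (fastforce simp: Bex_def)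
next
  assume "\<exists>n l.
    (\<forall>i<n. \<exists>j<n. \<exists>k<n. justified (idx l i) (idx l j) (idx l k)) \<and>
    (\<exists>i<n. idx l i = stmt e x y t)"
  then obtain n l where
    n: "\<forall>i<n. \<exists>j<n. \<exists>k<n. justified (idx l i) (idx l j) (idx l k)" and
    e: "\<exists>i<n. idx l i = stmt e x y t" by blast
  show "run (recf_of e) x y t"
  proof (rule run_if_certified[of "idx l ` {..<n}"])
    show "\<exists>r\<in>idx l ` {..<n}. \<exists>r'\<in>idx l ` {..<n}. justified q r r'" if "q \<in> idx l ` {..<n}" for q
      using that n by blast
    from e show "stmt e x y t \<in> idx l ` {..<n}" by (metis imageI lessThan_iff)
  qed
qed

section \<open>Uniform enumeration of the c.e. sets\<close>

lemma semidecidable_run: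
  assumes "computable e" "computable x" "computable y" "computable t"
  shows "semidecidable (\<lambda>z. run (recf_of (e z)) (x z) (y z) (t z))"
  unfolding run_iff_certified
  by (intro semidecidable_ex semidecidable_if_decidable comp_intros decidable_justified
    computable_comp[OF assms(1)] computable_comp[OF assms(2)] computable_comp[OF assms(3)]
    computable_comp[OF assms(4)])

lemma semidecidable_W [semi_intros]:
  assumes "computable e" "computable x"
  shows "semidecidable (\<lambda>z. x z \<in> W (e z))"
  unfolding W_def mem_Collect_eq
  by (intro semi_intros semidecidable_run comp_intros computable_comp[OF assms(1)]
    computable_comp[OF assms(2)])

lemma semidecidable_W_at [semi_intros]:
  assumes "computable e" "computable x" "computable s"
  shows "semidecidable (\<lambda>z. x z \<in> W_at (e z) (s z))"
  unfolding W_at_def mem_Collect_eq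
  by (intro semidecidable_conj semidecidable_ex;
    intro semidecidable_run semidecidable_if_decidable comp_intros assms
      computable_comp[OF assms(1)] computable_comp[OF assms(2)] computable_comp[OF assms(3)])

text \<open>From right to left, the program searches for a witness and thus halts exactly on the
  elements of \<open>A\<close>.\<close>

lemma ce_iff_semidecidable: "ce A \<longleftrightarrow> semidecidable (\<lambda>x. x \<in> A)"
proof
  assume "ce A"
  then show "semidecidable (\<lambda>x. x \<in> A)"
    unfolding ce_def by (auto intro: semidecidable_W comp_intros)
next
  assume "semidecidable (\<lambda>x. x \<in> A)"
  then obtain R where R: "decidable (\<lambda>z. R (pfst z) (psnd z))" "\<And>x. x \<in> A \<longleftrightarrow> (\<exists>s. R x s)"
    unfolding semidecidable_def by blast
  define g where "g z = 1 - (if R (pfst z) (psnd z) then 1 else 0 :: nat)" for z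
  have g: "g (prod_encode (x, y)) = 0 \<longleftrightarrow> R x y" for x y by (simp add: g_def)
  have "computable g"
    unfolding g_def using R(1) by (intro comp_intros) (simp only: decidable_def)
  from Mini_prog[OF this] obtain c where
    c: "\<And>x v. (\<exists>t. run c x v t) \<longleftrightarrow> R x v \<and> (\<forall>u<v. \<not> R x u)"
    unfolding g by blast
  obtain e where e: "recf_of e = c" using recf_of_surj by blast
  have "x \<in> A \<longleftrightarrow> (\<exists>y. R x y \<and> (\<forall>u<y. \<not> R x u))" for x
    unfolding R(2) using exists_least_iff[of "R x"] by blast
  then have "A = W e" unfolding W_def e by (simp add: c set_eq_iff)
  then show "ce A" unfolding ce_def by blast
qed

text \<open>
  The delay \<open>h\<close> is needed to define the sets \<open>B\<^sub>i\<close>, when \<open>d\<close> and \<open>m\<close> are not yet known; hence the order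
  of the quantifiers.
\<close>

lemma W_cut:
  "\<exists>h. computable h \<and> (\<forall>d m. \<exists>r. W r = {x \<in> W d. m \<le> x} \<and>
    (\<forall>s. {x \<in> W_at d s. m \<le> x} \<subseteq> W_at r (s + h s)))"
proof -
  \<comment> \<open>Searching for a zero of \<open>g\<close> on the pair \<open>(m, x)\<close> acts
    as a filter: it returns \<open>x\<close> if \<open>m \<le> x\<close> and diverges
    otherwise.\<close>
  define g where "g q = (if pfst (pfst q) \<le> psnd (pfst q) \<and> psnd q = psnd (pfst q) then 0 else 1 :: nat)"
    for q
  have "computable g" unfolding g_def by (intro comp_intros)
  from Mini_prog[OF this] obtain c where
    c: "\<And>z v. (\<exists>t. run c z v t) \<longleftrightarrow>
       g (prod_encode (z, v)) = 0 \<and> (\<forall>u<v. g (prod_encode (z, u)) \<noteq> 0)"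
    by blast
  have c: "(\<exists>t. run c (prod_encode (m, x)) v t) \<longleftrightarrow> m \<le> x \<and> v = x" for m x v
    unfolding c by (auto simp: g_def)
  obtain e where e: "recf_of e = c" using recf_of_surj by blast
  have "semidecidable (\<lambda>q. run (recf_of e) (pfst q) (psnd (pfst q)) (psnd q))"
    by (intro semidecidable_run comp_intros)
  then obtain R where R: "decidable (\<lambda>z. R (pfst z) (psnd z))"
    "\<And>q. run c (pfst q) (psnd (pfst q)) (psnd q) \<longleftrightarrow> (\<exists>s. R q s)"
    "\<And>q s s'. s \<le> s' \<Longrightarrow> R q s \<Longrightarrow> R q s'"
    unfolding e by (blast dest!: semidecidable_approx)
  \<comment> \<open>\<open>u\<close> bounds the running times of the filter and also the stages at
    which \<open>R\<close> confirms them. Decidability of \<open>R\<close> makes the least such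
    \<open>u\<close> computable.\<close>
  define H where "H s u \<longleftrightarrow> (\<forall>m<s. \<forall>x<s. m \<le> x \<longrightarrow>
      (\<exists>t<u. R (prod_encode (prod_encode (m, x), t)) u))" for s u
  have H: "\<exists>u. H s u" for s
  proof -
    have "\<exists>u. m \<le> x \<longrightarrow> (\<exists>t<u. R (prod_encode (prod_encode (m, x), t)) u)" for m x
    proof (cases "m \<le> x")
      case True
      then obtain t where "run c (prod_encode (m, x)) x t" using c by blast
      then obtain u where "R (prod_encode (prod_encode (m, x), t)) u"
        using R(2)[of "prod_encode (prod_encode (m, x), t)"] by auto
      then have "t < max u (Suc t) \<and> R (prod_encode (prod_encode (m, x), t)) (max u (Suc t))"
        by (auto intro: R(3)[rotated])
      then show ?thesis by blast
    qed simp
    then obtain u where u: "\<And>m x. m \<le> x \<Longrightarrow> \<exists>t<u m x. R (prod_encode (prod_encode (m, x), t)) (u m x)"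
      by metis
    define b where "b = Max ((\<lambda>(m, x). u m x) ` ({..<s} \<times> {..<s}))"
    have "u m x \<le> b" if "m < s" "x < s" for m x
      unfolding b_def by (rule Max_ge) (use that in \<open>auto\<close>)
    then have "H s b" unfolding H_def using u R(3) by (meson less_le_trans)
    then show ?thesis ..
  qed
  \<comment> \<open>The summands pay for the filter, for \<open>const_prog m\<close> with
    \<open>m < s\<close>, and for the constant overhead of composition.\<close>
  define h where "h s = (LEAST u. H s u) + 2 * s + 10" for s
  have "computable h" unfolding h_def
    by (intro comp_intros computable_Least H, unfold H_def)
      (intro comp_intros decidable_comp2[OF R(1)])
  moreover have "\<exists>r. W r = {x \<in> W d. m \<le> x} \<and> (\<forall>s. {x \<in> W_at d s. m \<le> x} \<subseteq> W_at r (s + h s))" for d m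
  proof -
    define b where "b = Fork (const_prog m) (Fork Fst Snd)"
    have b: "run b x (prod_encode (m, x)) (2 * m + 5)" for x
      unfolding b_def using run.fork[OF run_const_prog[of m x] run_Id[of x]] by (simp add: eval_nat_numeral)
    obtain r where r: "recf_of r = Comp (recf_of d) (Comp c b)" using recf_of_surj by blast
    have 1: "m \<le> x \<and> x \<in> W d" if "x \<in> W r" for x
    proof -
      from that obtain y t where "run (Comp (recf_of d) (Comp c b)) x y t" unfolding W_def r by blast
      then obtain u t1 t2 where u: "run (Comp c b) x u t1" and d: "run (recf_of d) u y t2" by cases
      from u obtain z t3 t4 where "run b x z t3" "run c z u t4" by cases
      with run_deterministic[OF b] have "run c (prod_encode (m, x)) u t4" by blast
      with c have "m \<le> x" "u = x" by blast+
      with d show ?thesis unfolding W_def by blast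
    qed
    have step: "run (Comp (recf_of d) (Comp c b)) x y (2 * m + 5 + t1 + 1 + t + 1)"
      if "run (recf_of d) x y t" "run c (prod_encode (m, x)) x t1" for x y t t1
      using run.comp[OF run.comp[OF b that(2)] that(1)] .
    have 2: "x \<in> W_at r (s + h s)" if x: "x \<in> W_at d s" and mx: "m \<le> x" for x s
    proof -
      from x obtain y t where t: "x < s" "t < s" "run (recf_of d) x y t" unfolding W_at_def by blast
      \<comment> \<open>Stage \<open>s\<close> shows only numbers below \<open>s\<close>, so
        \<open>m\<close> is below \<open>s\<close> too; this frees \<open>h\<close> from
        \<open>m\<close>. It is free of \<open>d\<close> because the program for \<open>W d\<close>
        runs on \<open>x\<close> itself after the filter, in its old time.\<close>
      from le_less_trans[OF mx t(1)] have ms: "m < s" .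
      have "H s (LEAST u. H s u)" using H by (rule LeastI_ex)
      with ms t(1) mx obtain t1 where t1: "t1 < (LEAST u. H s u)"
        and "R (prod_encode (prod_encode (m, x), t1)) (LEAST u. H s u)"
        unfolding H_def by blast
      with R(2)[of "prod_encode (prod_encode (m, x), t1)"]
      have c1: "run c (prod_encode (m, x)) x t1" by auto
      have "2 * m + 5 + t1 + 1 + t + 1 < s + h s"
        using t1 t(2) ms by (simp add: h_def)
      with step[OF t(3) c1] t(1) show ?thesis unfolding W_at_def r by (blast intro: trans_less_add1)
    qed
    have "x \<in> W r" if "x \<in> W d" "m \<le> x" for x
      using that 2 unfolding W_eq_UN_W_at by blast
    with 1 2 show ?thesis by blast
  qed
  ultimately show ?thesis by blast
qed

section \<open>Priority colourings\<close>

lemma eventually_eq_limit: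
  assumes "\<And>s s'. s \<le> s' \<Longrightarrow> R s \<Longrightarrow> R s'"
  shows "\<forall>\<^sub>F s in sequentially. R s = (\<exists>s. R s)"
  unfolding eventually_sequentially using assms by blast

text \<open>
  A number \<open>j = prod_encode (d, t)\<close> is a guess, \<open>G j y s b\<close> approximates the condition \<open>H j y b\<close> on it at \<open>y\<close>,
  and \<open>b\<close> tells whether \<open>y\<close> lies in the colour class of \<open>d\<close>.  In \<open>verified\<close>, the bound \<open>x < s\<close> leaves
  a wrong guess finitely many numbers, and \<open>\<not> c x s\<close> lets a correct guess be verified at every number
  that is never enumerated.
\<close>

locale colouring =
  fixes c :: "nat \<Rightarrow> nat \<Rightarrow> bool"
    and G :: "nat \<Rightarrow> nat \<Rightarrow> nat \<Rightarrow> bool \<Rightarrow> bool"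
    and H :: "nat \<Rightarrow> nat \<Rightarrow> bool \<Rightarrow> bool"
  assumes dec_c: "decidable (\<lambda>z. c (pfst z) (psnd z))"
    and mono_c: "\<And>x s s'. s \<le> s' \<Longrightarrow> c x s \<Longrightarrow> c x s'"
    and dec_G: "\<And>b. decidable (\<lambda>z. G (pfst z) (pfst (psnd z)) (psnd (psnd z)) b)"
    and limit_G: "\<And>j y b. \<forall>\<^sub>F s in sequentially. G j y s b = H j y b"
begin

text \<open>The default \<open>j = x\<close> makes the least number exist and costs each guess at
  most one unverified number.\<close>

fun col :: "nat \<Rightarrow> nat" where
  "col x = (LEAST j. j = x \<or>
    (\<exists>s>x. \<not> c x s \<and> (\<forall>y<x. G j y s (c y s \<and> pfst (col y) = pfst j))))"

declare col.simps [simp del]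

definition verified :: "nat \<Rightarrow> nat \<Rightarrow> bool" where
  "verified j x \<longleftrightarrow> (\<exists>s>x. \<not> c x s \<and> (\<forall>y<x. G j y s (c y s \<and> pfst (col y) = pfst j)))"

definition colour_class :: "nat \<Rightarrow> nat set" where
  "colour_class d = {x. (\<exists>s. c x s) \<and> pfst (col x) = d}"

definition correct :: "nat \<Rightarrow> bool" where
  "correct j \<longleftrightarrow> (\<forall>y. H j y (y \<in> colour_class (pfst j)))"

lemma col_eq: "col x = (LEAST j. j = x \<or> verified j x)"
  unfolding verified_def by (rule col.simps)

section \<open>Correct and incorrect guesses\<close>

lemma limit_G_class:
  "\<forall>\<^sub>F s in sequentially. G j y s (c y s \<and> pfst (col y) = pfst j)
    = H j y (y \<in> colour_class (pfst j))"
proof -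
  have "\<forall>\<^sub>F s in sequentially. c y s = (\<exists>s. c y s)"
    by (rule eventually_eq_limit) (rule mono_c)
  with limit_G[of j y "y \<in> colour_class (pfst j)"] show ?thesis
    by eventually_elim (simp add: colour_class_def)
qed

text \<open>Finitely many limits are reached at a common stage, and an \<open>x\<close> that is
  never enumerated sets no deadline for it.\<close>

lemma verified_outside:
  assumes "correct j" "\<And>s. \<not> c x s"
  shows "verified j x"
proof -
  have "\<forall>\<^sub>F s in sequentially. G j y s (c y s \<and> pfst (col y) = pfst j)" for y
    using limit_G_class[of j y] assms(1) by (simp add: correct_def)
  then have "\<forall>\<^sub>F s in sequentially. \<forall>y\<in>{..<x}. G j y s (c y s \<and> pfst (col y) = pfst j)"
    by (intro eventually_ball_finite) auto
  with eventually_gt_at_top[of x]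
  have "\<forall>\<^sub>F s in sequentially. x < s \<and> (\<forall>y\<in>{..<x}. G j y s (c y s \<and> pfst (col y) = pfst j))"
    by eventually_elim blast
  then obtain s where "x < s" "\<forall>y\<in>{..<x}. G j y s (c y s \<and> pfst (col y) = pfst j)"
    unfolding eventually_sequentially by blast
  with assms(2) show ?thesis unfolding verified_def by blast
qed

text \<open>The condition fails at some \<open>y\<close> from a stage \<open>s0\<close> on. Numbers
  above \<open>y\<close> can be verified only at stages before \<open>s0\<close>, and verifying
  \<open>x\<close> takes a stage beyond \<open>x\<close>.\<close>

lemma finite_verified_if_incorrect:
  assumes "\<not> correct j" shows "finite {x. verified j x}"
proof -
  from assms obtain y where "\<not> H j y (y \<in> colour_class (pfst j))" unfolding correct_def by blast
  with limit_G_class[of j y] obtain s0 where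
    "\<And>s. s \<ge> s0 \<Longrightarrow> \<not> G j y s (c y s \<and> pfst (col y) = pfst j)"
    unfolding eventually_sequentially by blast
  then have "x \<le> y \<or> x < s0" if "verified j x" for x
    using that unfolding verified_def by (meson leI less_trans)
  then have "{x. verified j x} \<subseteq> {..y} \<union> {..<s0}" by blast
  then show ?thesis by (rule finite_subset) simp
qed

text \<open>Such an \<open>x\<close> above \<open>j\<close> was taken by a smaller guess that it
  verified; smaller guesses are incorrect and verify finitely many numbers each.\<close>

lemma finite_verified_outside_class:
  assumes "correct j" "\<And>i. i < j \<Longrightarrow> \<not> correct i"
  shows "finite {x. verified j x \<and> (\<exists>s. c x s) \<and> x \<notin> colour_class (pfst j)}"
proof -
  have "x \<in> {..j} \<union> (\<Union>i<j. {x. verified i x})"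
    if "verified j x" "\<exists>s. c x s" "x \<notin> colour_class (pfst j)" for x
  proof (cases "x \<le> j")
    case False
    have "col x \<le> j" unfolding col_eq by (rule Least_le) (use that in simp)
    moreover have "col x \<noteq> j" using that unfolding colour_class_def by blast
    moreover have "col x = x \<or> verified (col x) x"
      unfolding col_eq by (rule LeastI_ex) blast
    ultimately show ?thesis using False by force
  qed simp
  then have "{x. verified j x \<and> (\<exists>s. c x s) \<and> x \<notin> colour_class (pfst j)}
    \<subseteq> {..j} \<union> (\<Union>i<j. {x. verified i x})" by blast
  then show ?thesis
    by (rule finite_subset) (use assms(2) finite_verified_if_incorrect in auto)
qed

section \<open>Effectiveness of the colours\<close>

lemma decidable_c:
  "computable f \<Longrightarrow> computable g \<Longrightarrow> decidable (\<lambda>x. c (f x) (g x))"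
  by (rule decidable_comp2[OF dec_c])

lemma decidable_G:
  assumes "computable f" "computable g" "computable h" "decidable B"
  shows "decidable (\<lambda>x. G (f x) (g x) (h x) (B x))"
proof -
  have "decidable (\<lambda>x. G (f x) (g x) (h x) b)" for b
    using decidable_comp[OF dec_G[of b], of "\<lambda>x. prod_encode (f x, prod_encode (g x, h x))"] assms(1-3)
    by (simp add: comp_intros)
  with assms(4) have "decidable (\<lambda>x. B x \<and> G (f x) (g x) (h x) True \<or> \<not> B x \<and> G (f x) (g x) (h x) False)"
    by (intro comp_intros)
  moreover have "(\<lambda>x. B x \<and> G (f x) (g x) (h x) True \<or> \<not> B x \<and> G (f x) (g x) (h x) False)
    = (\<lambda>x. G (f x) (g x) (h x) (B x))" by (rule ext) (metis (full_types))
  ultimately show ?thesis by (simp only:)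
qed

text \<open>\<open>f\<close> tabulates the colours of the numbers up to \<open>x\<close> that are enumerated by stage \<open>s\<close>.\<close>

definition table :: "nat \<Rightarrow> nat \<Rightarrow> nat \<Rightarrow> bool" where
  "table f s x \<longleftrightarrow> (\<forall>y<Suc x. c y s \<longrightarrow> idx f y = (LEAST j. j = y \<or> (\<exists>s'<s. y < s' \<and> \<not> c y s' \<and>
    (\<forall>u<y. G j u s' (c u s' \<and> pfst (idx f u) = pfst j)))))"

text \<open>By monotonicity \<open>\<not> c y s'\<close> forces \<open>s' < s\<close>, and at such
  stages \<open>f\<close> matters only for numbers already enumerated, where it is right.\<close>

lemma verified_bounded:
  assumes "c y s" "\<And>u. u < y \<Longrightarrow> c u s \<Longrightarrow> idx f u = col u"
  shows "verified j y \<longleftrightarrow> (\<exists>s'<s. y < s' \<and> \<not> c y s' \<and>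
    (\<forall>u<y. G j u s' (c u s' \<and> pfst (idx f u) = pfst j)))"
proof -
  have "(c u s' \<and> pfst (idx f u) = pfst j) = (c u s' \<and> pfst (col u) = pfst j)"
    if "u < y" "s' < s" for u s'
    using assms(2)[OF that(1)] mono_c[of s' s u] that(2) by auto
  moreover have "s' < s" if "\<not> c y s'" for s'
    using mono_c[of s s' y] assms(1) that by (meson leI)
  ultimately show ?thesis unfolding verified_def by (smt (verit))
qed

lemma table_correct:
  assumes "table f s x" shows "y \<le> x \<Longrightarrow> c y s \<Longrightarrow> idx f y = col y"
proof (induction y rule: less_induct)
  case (less y)
  have "idx f u = col u" if "u < y" "c u s" for u using less that by simp
  from verified_bounded[OF less.prems(2) this] less.prems assms show ?case
    by (simp add: table_def col_eq)
qed

text \<open>The true colours form a table. Together with \<open>table_correct\<close> this allows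
  the colour to be read off from any table found by search.\<close>

lemma table_exists: "\<exists>f. table f s x \<and> idx f x = col x"
proof -
  from idx_exists[of x col] obtain f where f: "\<And>i. i \<le> x \<Longrightarrow> idx f i = col i" by blast
  have "table f s x"
    unfolding table_def
  proof (intro allI impI)
    fix y assume y: "y < Suc x" "c y s"
    then have "idx f u = col u" if "u < y" "c u s" for u using f that by simp
    from verified_bounded[OF y(2) this] f y(1)
    show "idx f y = (LEAST j. j = y \<or> (\<exists>s'<s. y < s' \<and> \<not> c y s' \<and>
      (\<forall>u<y. G j u s' (c u s' \<and> pfst (idx f u) = pfst j))))"
      by (simp add: col_eq)
  qed
  with f show ?thesis by blast
qed

lemma col_iff_table:
  "(\<exists>s. c x s) \<and> col x = j \<longleftrightarrow> (\<exists>s f. c x s \<and> table f s x \<and> idx f x = j)"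
  using table_correct table_exists by (metis order_refl)

lemma semidecidable_col:
  "semidecidable (\<lambda>z. (\<exists>s. c (pfst z) s) \<and> col (pfst z) = psnd z)"
  unfolding col_iff_table table_def
  by (intro semidecidable_ex semidecidable_if_decidable)
    (intro comp_intros decidable_c decidable_G computable_Least | blast)+

lemma semidecidable_colour_class:
  "semidecidable (\<lambda>z. pfst z \<in> colour_class (psnd z))"
proof -
  have "pfst z \<in> colour_class (psnd z) \<longleftrightarrow>
      (\<exists>j. ((\<exists>s. c (pfst z) s) \<and> col (pfst z) = j) \<and> pfst j = psnd z)" for z
    unfolding colour_class_def by blast
  then show ?thesis
    by (simp only:) (intro semi_intros semidecidable_comp2[OF semidecidable_col]
      semidecidable_if_decidable comp_intros)
qed

text \<open>An enumerated number eventually reveals its colour, so membership in another class is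
  recognised as well. This makes each class a legal \<open>S\<close>.\<close>

lemma semidecidable_colour_class_complement:
  "semidecidable (\<lambda>x. (\<exists>s. c x s) \<and> x \<notin> colour_class d)"
proof -
  have "(\<exists>s. c x s) \<and> x \<notin> colour_class d \<longleftrightarrow>
      (\<exists>j. ((\<exists>s. c x s) \<and> col x = j) \<and> pfst j \<noteq> d)" for x
    unfolding colour_class_def by blast
  then show ?thesis
    by (simp only:) (intro semidecidable_ex semidecidable_conj semidecidable_comp2[OF semidecidable_col]
      semidecidable_if_decidable comp_intros)
qed

text \<open>
  Before \<open>x\<close> is enumerated, only the colours of the numbers already enumerated matter, so
  verification is semidecidable.
\<close>

lemma semidecidable_verified: "semidecidable (verified j)"
proof -
  have "verified j x \<longleftrightarrow> (\<exists>s f. x < s \<and> \<not> c x s \<and> table f s x \<and>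
      (\<forall>y<x. G j y s (c y s \<and> pfst (idx f y) = pfst j)))" for x
  proof -
    have "(c y s \<and> pfst (idx f y) = pfst j) = (c y s \<and> pfst (col y) = pfst j)"
      if "table f s x" "y < x" for f s y
      using table_correct[OF that(1), of y] that(2) by auto
    note E = this
    show ?thesis
    proof
      assume "verified j x"
      then obtain s where s: "x < s" "\<not> c x s" "\<forall>y<x. G j y s (c y s \<and> pfst (col y) = pfst j)"
        unfolding verified_def by blast
      obtain f where f: "table f s x" using table_exists by blast
      from s(3) have "\<forall>y<x. G j y s (c y s \<and> pfst (idx f y) = pfst j)"
        by (simp add: E[OF f])
      with s(1,2) f show "\<exists>s f. x < s \<and> \<not> c x s \<and> table f s x \<and>
        (\<forall>y<x. G j y s (c y s \<and> pfst (idx f y) = pfst j))" by blast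
    next
      assume "\<exists>s f. x < s \<and> \<not> c x s \<and> table f s x \<and>
        (\<forall>y<x. G j y s (c y s \<and> pfst (idx f y) = pfst j))"
      then obtain s f where s: "x < s" "\<not> c x s" and f: "table f s x"
        and *: "\<forall>y<x. G j y s (c y s \<and> pfst (idx f y) = pfst j)" by blast
      from * have "\<forall>y<x. G j y s (c y s \<and> pfst (col y) = pfst j)"
        by (simp add: E[OF f])
      with s show "verified j x" unfolding verified_def by blast
    qed
  qed
  then have "verified j = (\<lambda>x. \<exists>s f. x < s \<and> \<not> c x s \<and> table f s x \<and>
      (\<forall>y<x. G j y s (c y s \<and> pfst (idx f y) = pfst j)))" by (rule ext)
  then show ?thesis unfolding table_def
    by (simp only:) (intro semidecidable_ex semidecidable_if_decidable,
      (intro comp_intros decidable_c decidable_G computable_Least | blast)+)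
qed

end

section \<open>The game on even levels\<close>

named_theorems limit_intros

lemma limit_connectives [limit_intros]:
  assumes "\<forall>\<^sub>F s in sequentially. P s = p" "\<forall>\<^sub>F s in sequentially. R s = r"
  shows "\<forall>\<^sub>F s in sequentially. (P s \<and> R s) = (p \<and> r)"
    and "\<forall>\<^sub>F s in sequentially. (P s \<or> R s) = (p \<or> r)"
    and "\<forall>\<^sub>F s in sequentially. (P s \<longrightarrow> R s) = (p \<longrightarrow> r)"
    and "\<forall>\<^sub>F s in sequentially. (P s = R s) = (p = r)"
  by (use assms in eventually_elim, simp)+

lemma limit_not [limit_intros]:
  "\<forall>\<^sub>F s in sequentially. P s = p \<Longrightarrow> \<forall>\<^sub>F s in sequentially. (\<not> P s) = (\<not> p)"
  by simp

lemma limit_const [limit_intros]: "\<forall>\<^sub>F s in sequentially. p = p"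
  by simp

lemma limit_Ball_finite:
  assumes "finite I" "\<And>i. i \<in> I \<Longrightarrow> \<forall>\<^sub>F s in sequentially. P i s = p i"
  shows "\<forall>\<^sub>F s in sequentially. (\<forall>i\<in>I. P i s) = (\<forall>i\<in>I. p i)"
proof -
  have "\<forall>\<^sub>F s in sequentially. \<forall>i\<in>I. P i s = p i"
    using assms by (intro eventually_ball_finite) auto
  then show ?thesis by eventually_elim simp
qed

lemma W_at_subset_W: "W_at e s \<subseteq> W e"
  unfolding W_eq_UN_W_at by blast

text \<open>Finitely many enumerations have a common stage; it is needed because \<open>BB\<close>
  asks for all its announcements at one stage.\<close>

lemma Ball_W_iff:
  assumes "finite I"
  shows "(\<forall>i\<in>I. x \<in> W (e i)) \<longleftrightarrow> (\<exists>s. \<forall>i\<in>I. x \<in> W_at (e i) s)"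
proof
  assume *: "\<forall>i\<in>I. x \<in> W (e i)"
  have "\<forall>\<^sub>F s in sequentially. x \<in> W_at (e i) s" if "i \<in> I" for i
  proof -
    from * that obtain s where "x \<in> W_at (e i) s" unfolding W_eq_UN_W_at by blast
    then show ?thesis unfolding eventually_sequentially using W_at_mono by blast
  qed
  with assms have "\<forall>\<^sub>F s in sequentially. \<forall>i\<in>I. x \<in> W_at (e i) s"
    by (simp add: eventually_ball_finite)
  then show "\<exists>s. \<forall>i\<in>I. x \<in> W_at (e i) s" unfolding eventually_sequentially by blast
qed (use W_at_subset_W in blast)

lemma decidable_finite:
  assumes "finite F" shows "decidable (\<lambda>x. x \<in> F)"
  using assms
proof (induction F)
  case (insert a F)
  then show ?case unfolding insert_iff by (intro comp_intros)
qed (simp add: decidable_const)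

section \<open>The strategy against a given delay\<close>

definition wins ::
    "nat \<Rightarrow> nat set \<Rightarrow> (nat \<Rightarrow> nat set) \<Rightarrow> (nat \<Rightarrow> nat set) \<Rightarrow> nat set \<Rightarrow> (nat \<Rightarrow> nat set) \<Rightarrow> bool" where
  "wins k A B D S T \<longleftrightarrow>
    ((\<forall>i\<in>{1..k}. B i \<inter> (S - A) = D i \<inter> (S - A)) \<longrightarrow>
      (\<forall>i\<in>{1..<k}. (A \<union> T (i + 1)) \<inter> (S \<inter> T i) = B i \<inter> (S \<inter> T i)) \<and>
      A \<inter> (S \<inter> T k) = B k \<inter> (S \<inter> T k))"

lemma Q_even_iff: "Q_even k A \<longleftrightarrow> (\<exists>C. ce C \<and> A \<subset>m C \<and>
    (\<forall>B. ce_chain k B \<and> B 1 \<subseteq> C \<longrightarrow> (\<exists>D. ce_chain k D \<and> D 1 \<subseteq> C \<and>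
      (\<forall>S. ce S \<and> S \<sqsubset>c C \<longrightarrow> (\<exists>T. ce_chain k T \<and> - C \<subseteq> T 1 \<and> wins k A B D S T)))))"
  unfolding Q_even_def wins_def by (rule refl)

text \<open>The set is given by an approximation \<open>a\<close> instead of an enumeration by
  finite sets, so that the odd case can use it for \<open>A \<union> Y\<close>.\<close>

lemma Q_even_presentation:
  assumes k: "k \<ge> 1"
    and dec_a: "decidable (\<lambda>z. a (pfst z) (psnd z))"
    and mono_a: "\<And>x s s'. s \<le> s' \<Longrightarrow> a x s \<Longrightarrow> a x s'"
    and p: "mono p" "computable p"
    and Q: "Q_even k {x. \<exists>s. a x s}"
  shows "\<exists>t d. (\<forall>x. (\<forall>s. \<not> a x s) \<longleftrightarrow> (\<exists>i\<in>{1..k}. x \<in> W (t i) \<and> x \<notin> W (d i))) \<and>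
    (\<forall>i\<in>{1..k}. \<forall>x s. x \<in> W_at (t i) s \<and> x \<notin> W_at (d i) s \<longrightarrow> \<not> a x (p s))"
proof -
  define A where "A = {x. \<exists>s. a x s}"
  from Q obtain C where ceC: "ce C" and major: "A \<subset>m C" and
    game: "\<forall>B. ce_chain k B \<and> B 1 \<subseteq> C \<longrightarrow> (\<exists>D. ce_chain k D \<and> D 1 \<subseteq> C \<and>
      (\<forall>S. ce S \<and> S \<sqsubset>c C \<longrightarrow> (\<exists>T. ce_chain k T \<and> - C \<subseteq> T 1 \<and> wins k A B D S T)))"
    unfolding Q_even_iff A_def[symmetric] by (elim exE conjE) (rule that)
  have AC: "A \<subseteq> C" using major by (simp add: major_subset_def)

  from W_cut obtain h where comp_h: "computable h" and
    cut: "\<And>d m. \<exists>r. W r = {x \<in> W d. m \<le> x} \<and>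
      (\<forall>s. {x \<in> W_at d s. m \<le> x} \<subseteq> W_at r (s + h s))" by blast
  txt \<open>The announcements by \<open>W d\<^sub>1, \<dots>, W d\<^sub>i\<close> that \<open>B\<^sub>i\<close> accepts; late ones are rejected.\<close>
  define BB where "BB i d x \<longleftrightarrow> (\<exists>s. (\<forall>l\<in>{1..i}. x \<in> W_at (idx d l) s) \<and> \<not> a x (p (s + h s)))"
    for i d x
  have semi_BB: "semidecidable (\<lambda>z. BB i (pfst z) (psnd z))" for i
    unfolding BB_def
    by (intro semidecidable_ex semidecidable_conj semidecidable_Ball_finite semidecidable_W_at
        semidecidable_if_decidable)
      (intro finite_atLeastAtMost comp_intros decidable_comp2[OF dec_a] computable_comp[OF p(2)]
        computable_comp[OF comp_h])+
  have "\<exists>R. decidable (\<lambda>z. R (pfst z) (psnd z)) \<and> (\<forall>z. BB i (pfst z) (psnd z) \<longleftrightarrow> (\<exists>s. R z s)) \<and>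
    (\<forall>x s s'. s \<le> s' \<longrightarrow> R x s \<longrightarrow> R x s')" for i
    by (rule semidecidable_approx[OF semi_BB])
  then obtain bb where bb: "\<And>i. decidable (\<lambda>z. bb i (pfst z) (psnd z))"
    "\<And>i z. BB i (pfst z) (psnd z) \<longleftrightarrow> (\<exists>s. bb i z s)"
    "\<And>i z s s'. s \<le> s' \<Longrightarrow> bb i z s \<Longrightarrow> bb i z s'" by metis
  have "semidecidable (\<lambda>z. psnd z \<in> W (pfst z))" by (intro semi_intros comp_intros)
  from semidecidable_approx[OF this] obtain w where w: "decidable (\<lambda>z. w (pfst z) (psnd z))"
    "\<And>z. psnd z \<in> W (pfst z) \<longleftrightarrow> (\<exists>s. w z s)"
    "\<And>z s s'. s \<le> s' \<Longrightarrow> w z s \<Longrightarrow> w z s'" by blast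
  from ceC have "semidecidable (\<lambda>x. x \<in> C)" by (simp add: ce_iff_semidecidable)
  from semidecidable_approx[OF this] obtain c where c: "decidable (\<lambda>z. c (pfst z) (psnd z))"
    "\<And>x. x \<in> C \<longleftrightarrow> (\<exists>s. c x s)"
    "\<And>x s s'. s \<le> s' \<Longrightarrow> c x s \<Longrightarrow> c x s'" by blast
  have lim_a: "\<forall>\<^sub>F s in sequentially. a y s = (y \<in> A)" for y
    unfolding A_def mem_Collect_eq by (rule eventually_eq_limit) (rule mono_a)
  have lim_c: "\<forall>\<^sub>F s in sequentially. c y s = (y \<in> C)" for y
    unfolding c(2) by (rule eventually_eq_limit) (rule c(3))
  have lim_w: "\<forall>\<^sub>F s in sequentially. w (prod_encode (e, y)) s = (y \<in> W e)" for e y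
    using eventually_eq_limit[of "w (prod_encode (e, y))"] w(2)[of "prod_encode (e, y)"] w(3) by simp
  have lim_bb: "\<forall>\<^sub>F s in sequentially. bb i (prod_encode (d, y)) s = BB i d y" for i d y
    using eventually_eq_limit[of "bb i (prod_encode (d, y))"] bb(2)[of i "prod_encode (d, y)"] bb(3)
    by simp

  txt \<open>
    Everything the final argument uses about a guess \<open>j\<close> of \<open>(D, T)\<close>, so the actual answer \<open>(D, T)\<close> need
    not be recognised.
  \<close>
  define H where "H j y b \<longleftrightarrow>
      (y \<in> C \<or> y \<in> W (idx (psnd j) 1) \<and> y \<notin> W (idx (pfst j) 1)) \<and>
      (b \<longrightarrow> (\<forall>i\<in>{1..k}. (\<forall>l\<in>{1..i}. y \<in> W (idx (psnd j) l)) \<longrightarrow>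
        ((y \<in> A \<or> i < k \<and> y \<in> W (idx (psnd j) (i + 1))) \<longleftrightarrow> BB i (pfst j) y)))" for j y b
  \<comment> \<open>Each part of \<open>H\<close> is replaced by its monotone approximation.
    \<open>G\<close> itself need not be monotone in \<open>s\<close>, but it has a limit.\<close>
  define G where "G j y s b \<longleftrightarrow>
      (c y s \<or> w (prod_encode (idx (psnd j) 1, y)) s \<and> \<not> w (prod_encode (idx (pfst j) 1, y)) s) \<and>
      (b \<longrightarrow> (\<forall>i\<in>{1..k}. (\<forall>l\<in>{1..i}. w (prod_encode (idx (psnd j) l, y)) s) \<longrightarrow>
        ((a y s \<or> i < k \<and> w (prod_encode (idx (psnd j) (i + 1), y)) s) \<longleftrightarrow>
          bb i (prod_encode (pfst j, y)) s)))" for j y s b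
  interpret colouring c G H
  proof
    show "decidable (\<lambda>z. c (pfst z) (psnd z))" by (rule c(1))
    show "c x s'" if "s \<le> s'" "c x s" for x s s' using c(3) that .
    show "decidable (\<lambda>z. G (pfst z) (pfst (psnd z)) (psnd (psnd z)) b)" for b
      unfolding G_def
      by (intro comp_intros decidable_Ball_finite finite_atLeastAtMost decidable_comp2[OF c(1)]
          decidable_comp2[OF w(1)] decidable_comp2[OF bb(1)] decidable_comp2[OF dec_a])
    show "\<forall>\<^sub>F s in sequentially. G j y s b = H j y b" for j y b
      unfolding G_def H_def
      by (intro limit_intros limit_Ball_finite finite_atLeastAtMost lim_a lim_c lim_w lim_bb)
  qed
  have in_class: "x \<in> colour_class d \<longleftrightarrow> x \<in> C \<and> pfst (col x) = d" for x d
    by (simp add: colour_class_def c(2))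
  have split: "ce (colour_class d)" "colour_class d \<sqsubset>c C" for d
  proof -
    show "ce (colour_class d)"
      unfolding ce_iff_semidecidable
      by (intro semidecidable_comp2[OF semidecidable_colour_class] comp_intros)
    have "ce {x. (\<exists>s. c x s) \<and> x \<notin> colour_class d}"
      unfolding ce_iff_semidecidable mem_Collect_eq
      by (rule semidecidable_colour_class_complement)
    moreover have "colour_class d \<union> {x. (\<exists>s. c x s) \<and> x \<notin> colour_class d} = C"
      "colour_class d \<inter> {x. (\<exists>s. c x s) \<and> x \<notin> colour_class d} = {}"
      using in_class c(2) by blast+
    ultimately show "colour_class d \<sqsubset>c C" unfolding ce_split_def by blast
  qed

  \<comment> \<open>\<open>BB\<close> is defined for all \<open>d\<close> at once and does not
    mention colours, so letting the colour of \<open>x\<close> select \<open>d\<close> is not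
    circular.\<close>
  define B where "B i = {x \<in> C. BB i (pfst (col x)) x}" for i
  have B_class: "x \<in> B i \<longleftrightarrow> BB i d x" if "x \<in> colour_class d" for i d x
    using that by (simp add: B_def in_class)
  have "x \<in> B i \<longleftrightarrow> (\<exists>j. ((\<exists>s. c x s) \<and> col x = j) \<and> BB i (pfst j) x)" for x i
    unfolding B_def by (simp add: c(2))
  then have "ce (B i)" for i
    unfolding ce_iff_semidecidable
    by (simp only:) (intro semidecidable_ex semidecidable_conj
      semidecidable_comp2[OF semidecidable_col] semidecidable_comp2[OF semi_BB] comp_intros)
  moreover have "B (i + 1) \<subseteq> B i" for i
    unfolding B_def BB_def by fastforce
  ultimately have "ce_chain k B" unfolding ce_chain_def by blast
  moreover have "B 1 \<subseteq> C" unfolding B_def by blast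
  ultimately obtain D where D: "ce_chain k D" "D 1 \<subseteq> C" and response:
    "\<And>S. ce S \<Longrightarrow> S \<sqsubset>c C \<Longrightarrow> \<exists>T. ce_chain k T \<and> - C \<subseteq> T 1 \<and> wins k A B D S T"
    using game by metis

  have index: "\<exists>d. \<forall>i\<in>{1..k}. F i = W (idx d i)" if "ce_chain k F" for F
  proof -
    from that have "\<forall>i. \<exists>e. i \<in> {1..k} \<longrightarrow> F i = W e" unfolding ce_chain_def ce_def by blast
    then obtain g where g: "\<And>i. i \<in> {1..k} \<Longrightarrow> F i = W (g i)" by metis
    obtain d where "\<And>i. i \<le> k \<Longrightarrow> idx d i = g i" using idx_exists by blast
    with g show ?thesis by (intro exI[of _ d]) simp
  qed
  have chain_mono: "F i \<subseteq> F l" if "ce_chain k F" "1 \<le> l" "l \<le> i" "i \<le> k" for F i l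
    using that(3,4)
  proof (induction i rule: dec_induct)
    case (step n)
    with that(1,2) show ?case unfolding ce_chain_def by fastforce
  qed simp

  have "\<exists>j. correct j"
  proof -
    from index[OF D(1)] obtain d where d: "\<And>i. i \<in> {1..k} \<Longrightarrow> D i = W (idx d i)" by blast
    \<comment> \<open>The code of the actual \<open>D\<close> determines the class to play on.
      \<open>T\<close> may depend on this class, hence the class must not depend on
      \<open>t\<close>.\<close>
    define S where "S = colour_class d"
    from response[OF split, of d] obtain T where T: "ce_chain k T" "- C \<subseteq> T 1"
      and win: "wins k A B D S T"
      unfolding S_def by blast
    \<comment> \<open>Outside \<open>A\<close> no announcement is late, and as \<open>D\<close> is
      nested, being announced by all levels up to \<open>i\<close> means lying in
      \<open>D i\<close>.\<close>
    have "x \<in> B i \<longleftrightarrow> x \<in> D i" if x: "x \<in> S" "x \<notin> A" and i: "i \<in> {1..k}" for x i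
    proof -
      from x(2) have na: "\<not> a x s" for s by (auto simp: A_def)
      have "x \<in> B i \<longleftrightarrow> (\<exists>s. \<forall>l\<in>{1..i}. x \<in> W_at (idx d l) s)"
        using x(1) by (simp add: S_def B_class BB_def na)
      also have "\<dots> \<longleftrightarrow> (\<forall>l\<in>{1..i}. x \<in> W (idx d l))"
        by (simp add: Ball_W_iff)
      also have "\<dots> \<longleftrightarrow> (\<forall>l\<in>{1..i}. x \<in> D l)" using d i by auto
      also have "\<dots> \<longleftrightarrow> x \<in> D i"
        using chain_mono[OF D(1), of _ i] i by (meson atLeastAtMost_iff order_refl subsetD)
      finally show ?thesis .
    qed
    then have "B i \<inter> (S - A) = D i \<inter> (S - A)" if "i \<in> {1..k}" for i
      using that by blast
    with win have win: "\<And>i. i \<in> {1..<k} \<Longrightarrow> (A \<union> T (i + 1)) \<inter> (S \<inter> T i) = B i \<inter> (S \<inter> T i)"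
      "A \<inter> (S \<inter> T k) = B k \<inter> (S \<inter> T k)"
      unfolding wins_def by blast+
    from index[OF T(1)] obtain t where t: "\<And>i. i \<in> {1..k} \<Longrightarrow> T i = W (idx t i)" by blast
    have "correct (prod_encode (d, t))"
      unfolding correct_def H_def prod_encode_inverse fst_conv snd_conv S_def[symmetric]
    proof (intro allI conjI impI ballI)
      fix y
      show "y \<in> C \<or> y \<in> W (idx t 1) \<and> y \<notin> W (idx d 1)"
        using T(2) D(2) t[of 1] d[of 1] k by auto
      fix i
      assume y: "y \<in> S" and i: "i \<in> {1..k}" and "\<forall>l\<in>{1..i}. y \<in> W (idx t l)"
      then have yT: "y \<in> T i" using t by auto
      show "(y \<in> A \<or> i < k \<and> y \<in> W (idx t (i + 1))) \<longleftrightarrow> BB i d y"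
      proof (cases "i = k")
        case True
        then show ?thesis using win(2) y yT B_class[of y d i] by (auto simp: S_def)
      next
        case False
        then have i': "i \<in> {1..<k}" "i + 1 \<in> {1..k}" using i by auto
        then have "i < k" by simp
        moreover have "y \<in> A \<or> y \<in> T (i + 1) \<longleftrightarrow> y \<in> B i" using win(1)[OF i'(1)] y yT by blast
        ultimately show ?thesis using y B_class[of y d i] t[OF i'(2)] by (simp add: S_def)
      qed
    qed
    then show ?thesis ..
  qed
  then obtain j where j: "correct j" "\<And>i. i < j \<Longrightarrow> \<not> correct i"
    using exists_least_iff[of correct] by blast

  define d where "d = pfst j"
  \<comment> \<open>A guess need not code a nested sequence, so the running intersection is
    taken.\<close>
  define T where "T i = {x. \<forall>l\<in>{1..i}. x \<in> W (idx (psnd j) l)}" for i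
  have correct_out: "x \<in> T 1" "x \<notin> W (idx d 1)" if "x \<notin> C" for x
    using j(1) that unfolding correct_def H_def T_def d_def by auto
  have correct_in: "x \<in> A \<or> i < k \<and> x \<in> W (idx (psnd j) (i + 1)) \<longleftrightarrow> BB i d x"
    if "x \<in> colour_class d" "i \<in> {1..k}" "x \<in> T i" for x i
    using j(1) that unfolding correct_def H_def T_def d_def by auto
  define R where "R = {x. verified j x}"
  \<comment> \<open>The major subset property is applied to this intersection, so that almost every
    number outside \<open>A\<close> is both verified and in \<open>T 1\<close>.\<close>
  have "ce (T 1 \<inter> R)"
    unfolding ce_iff_semidecidable T_def R_def Int_iff mem_Collect_eq
    by (intro semidecidable_conj semidecidable_verified semidecidable_Ball_finite semidecidable_W
      finite_atLeastAtMost comp_intros)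
  then obtain e where e: "T 1 \<inter> R = W e" unfolding ce_def by blast
  have "- C \<subseteq> W e"
    using correct_out verified_outside[OF j(1)] c(2) unfolding R_def e[symmetric] by blast
  with major have "finite (- A - T 1 \<inter> R)" unfolding major_subset_def e by simp
  moreover have "finite {x \<in> R. x \<in> C \<and> x \<notin> colour_class d}"
    using finite_verified_outside_class[OF j] unfolding R_def d_def by (simp add: c(2))
  ultimately have "finite ((- A - T 1 \<inter> R) \<union> {x \<in> R. x \<in> C \<and> x \<notin> colour_class d})"
    by (rule finite_UnI)
  \<comment> \<open>\<open>m\<close> lies above both kinds of exceptions: numbers outside
    \<open>A\<close> missing from \<open>T 1 \<inter> R\<close>, and verified numbers of
    \<open>C\<close> outside the class of \<open>d\<close>.\<close>
  from this[unfolded finite_nat_set_iff_bounded] obtain m where m: "\<And>x. x \<in> - A - T 1 \<inter> R \<Longrightarrow> x < m"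
    "\<And>x. x \<in> R \<Longrightarrow> x \<in> C \<Longrightarrow> x \<notin> colour_class d \<Longrightarrow> x < m" by blast

  have "\<forall>i. \<exists>r. W r = {x \<in> W (idx d i). m \<le> x} \<and>
      (\<forall>s. {x \<in> W_at (idx d i) s. m \<le> x} \<subseteq> W_at r (s + h s))"
    using cut by blast
  then obtain r where r: "\<And>i. W (r i) = {x \<in> W (idx d i). m \<le> x}"
    "\<And>i s. {x \<in> W_at (idx d i) s. m \<le> x} \<subseteq> W_at (r i) (s + h s)" by metis
  txt \<open>
    The sets \<open>W d\<^sub>i\<close> must not be slowed down, so they are corrected below \<open>m\<close> by the cut with delay \<open>h\<close>; the sets \<open>X i\<close> may be enumerated arbitrarily late.
  \<close>
  define X where "X i = {x. m \<le> x \<and> x \<in> R \<and> x \<in> T i} \<union> {x. x < m \<and> x \<notin> A}" for i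
  have "ce (X i)" for i
  proof -
    have "finite {x. x < m \<and> x \<notin> A}" by simp
    from decidable_finite[OF this] have "semidecidable (\<lambda>x. x < m \<and> x \<notin> A)"
      by (simp add: semidecidable_if_decidable)
    then have "semidecidable (\<lambda>x. (m \<le> x \<and> verified j x \<and> (\<forall>l\<in>{1..i}. x \<in> W (idx (psnd j) l))) \<or>
        (x < m \<and> x \<notin> A))"
      by (rule semidecidable_disj[rotated])
        (intro semidecidable_conj semidecidable_verified semidecidable_Ball_finite semidecidable_W
          finite_atLeastAtMost comp_intros semidecidable_if_decidable[OF decidable_le])
    then show ?thesis by (simp add: ce_iff_semidecidable X_def T_def R_def)
  qed
  then obtain t where t: "\<And>i. X i = W (t i)" unfolding ce_def by metis

  have tail: "x \<in> C \<Longrightarrow> x \<in> colour_class d" if "m \<le> x" "x \<in> R" for x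
    using m(2) that by (meson leD)
  \<comment> \<open>For elements of \<open>A\<close> the left side of \<open>correct_in\<close>
    holds at every level they reach, so an announcement in time exists there.\<close>
  have inA: "BB i d x" if "x \<in> A" "m \<le> x" "x \<in> R" "x \<in> T i" "i \<in> {1..k}" for x i
    using correct_in[OF tail] that AC by blast
  have "x \<notin> A \<longleftrightarrow> (\<exists>i\<in>{1..k}. x \<in> X i \<and> x \<notin> W (r i))" for x
  proof (cases "x < m")
    case True
    then have "x \<in> X i \<longleftrightarrow> x \<notin> A" "x \<notin> W (r i)" for i by (auto simp: X_def r)
    with k show ?thesis by auto
  next
    case False
    then have mx: "m \<le> x" by simp
    then have X: "x \<in> X i \<and> x \<notin> W (r i) \<longleftrightarrow> x \<in> R \<and> x \<in> T i \<and> x \<notin> W (idx d i)" for i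
      by (auto simp: X_def r)
    show ?thesis unfolding X
    proof
      assume xA: "x \<notin> A"
      then have xR: "x \<in> R" "x \<in> T 1" using m(1) mx by (meson ComplI DiffI IntD1 IntD2 leD)+
      show "\<exists>i\<in>{1..k}. x \<in> R \<and> x \<in> T i \<and> x \<notin> W (idx d i)"
      proof (cases "x \<in> C")
        case False
        with correct_out k xR show ?thesis by (intro bexI[of _ 1]) auto
      next
        case True
        \<comment> \<open>At the last level reached, neither \<open>A\<close> nor the next level
          contains \<open>x\<close>, so \<open>correct_in\<close> denies \<open>BB\<close>. Nothing
          is late for \<open>x\<close> outside \<open>A\<close>; hence some level up to
          \<open>i\<close> never announces it.\<close>
        define i where "i = Max {i \<in> {1..k}. x \<in> T i}"
        have fin: "finite {i \<in> {1..k}. x \<in> T i}" by simp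
        have "i \<in> {i \<in> {1..k}. x \<in> T i}"
          unfolding i_def by (rule Max_in[OF fin]) (use k xR in auto)
        then have i: "i \<in> {1..k}" "x \<in> T i" by auto
        have "\<not> (i < k \<and> x \<in> W (idx (psnd j) (i + 1)))"
        proof
          assume *: "i < k \<and> x \<in> W (idx (psnd j) (i + 1))"
          with i have "i + 1 \<in> {i \<in> {1..k}. x \<in> T i}" by (auto simp: T_def le_Suc_eq)
          from Max_ge[OF fin this] show False by (simp add: i_def)
        qed
        with correct_in[OF tail[OF mx xR(1) True] i] xA have "\<not> BB i d x" by blast
        moreover from xA have na: "\<not> a x s" for s by (auto simp: A_def)
        ultimately have *: "\<not> (\<forall>l\<in>{1..i}. x \<in> W_at (idx d l) s)" for s
          by (simp add: BB_def)
        have "\<not> (\<forall>l\<in>{1..i}. x \<in> W (idx d l))" using * by (simp add: Ball_W_iff)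
        then obtain l where l: "l \<in> {1..i}" "x \<notin> W (idx d l)" by blast
        with i have "x \<in> T l" "l \<in> {1..k}" by (auto simp: T_def)
        with l xR(1) show ?thesis by blast
      qed
    next
      assume "\<exists>i\<in>{1..k}. x \<in> R \<and> x \<in> T i \<and> x \<notin> W (idx d i)"
      then obtain i where i: "i \<in> {1..k}" "x \<in> R" "x \<in> T i" "x \<notin> W (idx d i)" by blast
      show "x \<notin> A"
      proof
        assume "x \<in> A"
        from inA[OF this mx i(2,3,1)] i(1,4) W_at_subset_W show False unfolding BB_def by fastforce
      qed
    qed
  qed
  moreover have "\<not> a x (p s)" if i: "i \<in> {1..k}" and x: "x \<in> W_at (t i) s" "x \<notin> W_at (r i) s" for i x s
  proof
    assume ax: "a x (p s)"
    then have xA: "x \<in> A" unfolding A_def by blast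
    have "x \<in> X i" using x(1) W_at_subset_W t by blast
    with xA have xR: "m \<le> x" "x \<in> R" "x \<in> T i" by (auto simp: X_def)
    from inA[OF xA xR i] obtain s' where s': "\<forall>l\<in>{1..i}. x \<in> W_at (idx d l) s'" "\<not> a x (p (s' + h s'))"
      unfolding BB_def by blast
    \<comment> \<open>The accepted announcement at \<open>s'\<close> reaches \<open>W (r i)\<close>
      by \<open>s' + h s'\<close>, the very stage tested in \<open>BB\<close>; monotonicity of
      \<open>p\<close> puts this no later than \<open>s\<close>.\<close>
    have "\<not> p s \<le> p (s' + h s')" using mono_a ax s'(2) by blast
    then have "s' + h s' \<le> s" using p(1) by (meson monoD linear)
    moreover have "x \<in> W_at (r i) (s' + h s')" using r(2)[of i s'] s'(1) i xR(1) by auto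
    ultimately show False using W_at_mono x(2) by blast
  qed
  ultimately show ?thesis
    by (intro exI[of _ t] exI[of _ r]) (simp add: t A_def)
qed

section \<open>Tardiness\<close>

text \<open>The bit of a canonical index at \<open>x\<close> is expressed by sums, products, powers
  and bounded quantifiers, so \<open>comp_intros\<close> can decide membership in a stage.\<close>

lemma odd_div_power_iff:
  "odd (c div 2 ^ x) \<longleftrightarrow> (\<exists>q<Suc c. \<exists>r<2 ^ x. c = (2 * q + 1) * 2 ^ x + r)" for c x :: nat
proof
  assume "odd (c div 2 ^ x)"
  then obtain q where q: "c div 2 ^ x = 2 * q + 1" by (elim oddE)
  have c: "c = (2 * q + 1) * 2 ^ x + c mod 2 ^ x"
    unfolding q[symmetric] by (rule div_mult_mod_eq[symmetric])
  have "q \<le> c div 2 ^ x" using q by simp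
  also have "\<dots> \<le> c" by (rule div_le_dividend)
  finally have "q < Suc c" by simp
  moreover have "c mod 2 ^ x < 2 ^ x" by simp
  ultimately show "\<exists>q<Suc c. \<exists>r<2 ^ x. c = (2 * q + 1) * 2 ^ x + r" using c by blast
next
  assume "\<exists>q<Suc c. \<exists>r<2 ^ x. c = (2 * q + 1) * 2 ^ x + r"
  then obtain q r where "r < 2 ^ x" "c = (2 * q + 1) * 2 ^ x + r" by blast
  then have "c div 2 ^ x = 2 * q + 1"
    by (intro div_nat_eqI) (simp_all add: algebra_simps)
  then show "odd (c div 2 ^ x)" by simp
qed

lemma decidable_enumeration:
  assumes "computable_enumeration As A"
  shows "decidable (\<lambda>z. pfst z \<in> As (psnd z))"
proof -
  from assms have fin: "finite (As s)" and comp: "computable (\<lambda>s. set_encode (As s))" for s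
    by (simp_all add: computable_enumeration_def)
  have "x \<in> As s \<longleftrightarrow> x \<in> set_decode (set_encode (As s))" for x s
    by (simp add: set_encode_inverse[OF fin])
  then have "x \<in> As s \<longleftrightarrow> (\<exists>q<Suc (set_encode (As s)). \<exists>r<2 ^ x.
      set_encode (As s) = (2 * q + 1) * 2 ^ x + r)" for x s
    unfolding set_decode_def mem_Collect_eq odd_div_power_iff .
  then show ?thesis by (simp only:) (intro comp_intros computable_comp[OF comp])
qed

section \<open>From pairs of indices to n-c.e. presentations\<close>

lemma diff_union_pairs:
  "diff_union (concat (map (\<lambda>i. [F i, G i]) is)) = (\<Union>i\<in>set is. F i - G i)"
  by (induction "is") auto

lemma length_concat_pairs: "length (concat (map (\<lambda>i. [f i, g i]) is)) = 2 * length is"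
  by (induction "is") auto

text \<open>This serves both parities, with \<open>Y\<close> empty for even levels. The stages of
  \<open>Y\<close> are joined to those of \<open>A\<close>, so obeying the delay for the union gives
  it for \<open>A\<close>.\<close>

lemma Q_even_tardy_presentation:
  assumes k: "k \<ge> 1" and Y: "ce Y" "Y \<subseteq> - A" and Q: "Q_even k (A \<union> Y)"
    and As: "computable_enumeration As A" and p: "mono p" "computable p"
  shows "\<exists>es. length es = 2 * k \<and> - A = diff_union (map W es) \<union> Y \<and>
    (\<forall>x s. x \<in> diff_union (map (\<lambda>e. W_at e s) es) \<longrightarrow> x \<notin> As (p s))"
proof -
  from Y(1) have "semidecidable (\<lambda>x. x \<in> Y)" by (simp add: ce_iff_semidecidable)
  from semidecidable_approx[OF this] obtain R where R: "decidable (\<lambda>z. R (pfst z) (psnd z))"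
    "\<And>x. x \<in> Y \<longleftrightarrow> (\<exists>s. R x s)" "\<And>x s s'. s \<le> s' \<Longrightarrow> R x s \<Longrightarrow> R x s'" by blast
  from As have As_mono: "As s \<subseteq> As s'" if "s \<le> s'" for s s'
    using lift_Suc_mono_le[of As, OF _ that] by (simp add: computable_enumeration_def)
  from As have As_UN: "x \<in> A \<longleftrightarrow> (\<exists>s. x \<in> As s)" for x by (auto simp: computable_enumeration_def)
  define a where "a x s \<longleftrightarrow> x \<in> As s \<or> R x s" for x s
  have "decidable (\<lambda>z. a (pfst z) (psnd z))"
    unfolding a_def by (intro comp_intros decidable_enumeration[OF As] R(1))
  moreover have "a x s'" if "s \<le> s'" "a x s" for x s s'
    using that As_mono R(3) unfolding a_def by blast
  moreover have AY: "A \<union> Y = {x. \<exists>s. a x s}" unfolding a_def using As_UN R(2) by blast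
  moreover note Q[unfolded AY]
  ultimately obtain t d where
    td: "\<And>x. (\<forall>s. \<not> a x s) \<longleftrightarrow> (\<exists>i\<in>{1..k}. x \<in> W (t i) \<and> x \<notin> W (d i))"
    "\<And>i x s. i \<in> {1..k} \<Longrightarrow> x \<in> W_at (t i) s \<Longrightarrow> x \<notin> W_at (d i) s \<Longrightarrow> \<not> a x (p s)"
    using Q_even_presentation[OF k _ _ p, of a] by blast
  define es where "es = concat (map (\<lambda>i. [t i, d i]) [1..<Suc k])"
  have es: "diff_union (map F es) = (\<Union>i\<in>{1..k}. F (t i) - F (d i))" for F
    using diff_union_pairs[of "\<lambda>i. F (t i)" "\<lambda>i. F (d i)" "[1..<Suc k]"]
    unfolding es_def by (simp add: map_concat comp_def atLeastLessThanSuc_atLeastAtMost del: upt_Suc)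
  have "x \<in> - (A \<union> Y) \<longleftrightarrow> x \<in> diff_union (map W es)" for x
    unfolding AY es using td(1)[of x] by auto
  then have "- (A \<union> Y) = diff_union (map W es)" by blast
  with Y(2) have "- A = diff_union (map W es) \<union> Y" by blast
  moreover have "length es = 2 * k" unfolding es_def by (simp add: length_concat_pairs del: upt_Suc)
  moreover have "x \<notin> As (p s)" if "x \<in> diff_union (map (\<lambda>e. W_at e s) es)" for x s
    using that td(2) unfolding es a_def by blast
  ultimately show ?thesis by blast
qed

text \<open>A prefix of even length leaves the pairing of the remaining sets unshifted.\<close>

lemma diff_union_append:
  "even (length Xs) \<Longrightarrow> diff_union (Xs @ Zs) = diff_union Xs \<union> diff_union Zs"
  by (induction Xs rule: diff_union.induct) auto

lemma ce_empty: "ce {}"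
  unfolding ce_iff_semidecidable by (simp add: semidecidable_if_decidable decidable_const)

theorem theorem3p3:
  fixes n :: nat and A :: "nat set"
  assumes "n \<ge> 2" and "ce A" and "Q n A"
  shows "tardy n A"
  unfolding tardy_def
proof (intro conjI allI impI, fact \<open>ce A\<close>, elim conjE)
  fix As p
  assume As: "computable_enumeration As A" and p: "mono p" "computable p"
  define k where "k = n div 2"
  have k: "k \<ge> 1" using \<open>n \<ge> 2\<close> by (simp add: k_def)
  have "\<exists>es. length es = n \<and> - A = diff_union (map W es) \<and>
    (\<forall>x s. x \<in> diff_union (map (\<lambda>e. W_at e s) es) \<longrightarrow> x \<notin> As (p s))"
  proof (cases "even n")
    case True
    with \<open>Q n A\<close> have "Q_even k (A \<union> {})" by (simp add: Q_def k_def)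
    from Q_even_tardy_presentation[OF k ce_empty _ this As p] True show ?thesis
      by (auto simp: k_def)
  next
    case False
    with \<open>Q n A\<close> obtain Y where Y: "ce Y" "Y \<subseteq> - A" "Q_even k (A \<union> Y)"
      unfolding Q_def Q_odd_def k_def by auto
    then obtain y where y: "Y = W y" unfolding ce_def by blast
    from Q_even_tardy_presentation[OF k Y As p] obtain es where
      es: "length es = 2 * k" "- A = diff_union (map W es) \<union> Y"
      "\<And>x s. x \<in> diff_union (map (\<lambda>e. W_at e s) es) \<Longrightarrow> x \<notin> As (p s)" by blast
    have "length (es @ [y]) = n" using es(1) False by (simp add: k_def)
    moreover have "- A = diff_union (map W (es @ [y]))"
      using es(1,2) by (simp add: diff_union_append y)
    moreover have "x \<notin> As (p s)" if x: "x \<in> diff_union (map (\<lambda>e. W_at e s) (es @ [y]))" for x s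
    proof (cases "x \<in> Y")
      \<comment> \<open>Elements of \<open>Y\<close> never enter \<open>A\<close>, so the unpaired
        last set may show them at any stage.\<close>
      case True
      with Y(2) As show ?thesis by (auto simp: computable_enumeration_def)
    next
      case False
      with x es(1) W_at_subset_W[of y s] have "x \<in> diff_union (map (\<lambda>e. W_at e s) es)"
        by (auto simp: diff_union_append y)
      then show ?thesis by (rule es(3))
    qed
    ultimately show ?thesis by blast
  qed
  then obtain es where es: "length es = n" "- A = diff_union (map W es)"
    "\<And>x s. x \<in> diff_union (map (\<lambda>e. W_at e s) es) \<Longrightarrow> x \<notin> As (p s)" by blast
  from tuple_of_surj[OF _ es(1)] \<open>n \<ge> 2\<close> obtain e where "tuple_of n e = es" by auto
  with es show "\<exists>e. X_set n e = - A \<and> (\<forall>x s. x \<in> X_at n e s \<longrightarrow> x \<notin> As (p s))"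
    unfolding X_set_def X_at_def by (intro exI[of _ e]) auto
qed

end
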